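(* Let $A$ and $B$ be finitely generated groups, and let $A'<A$ and $B'<B$ be finitely generated subgroups with distortion functions $\Delta_{A'}^A(n)=f(n)$ and $\Delta_{B'}^B(n)=g(n)$. Then $$(f+g)(n)\preceq\Delta_{A'\wr B'}^{A\wr B}(n),\qquad (f+g)(n)\sim\max(f(n),g(n)).$$ Moreover: - if both $f$ and $g$ are equivalent to superadditive functions, then $\Delta_{A'\wr B'}^{A\wr B}(n)\preceq\max(f(n),g(n))$; - if $f$ is equivalent to a superadditive function but $g$ is not, then $\Delta_{A'\wr B'}^{A\wr B}(n)\preceq\max(f(n),n\,g(n))$; - if $g$ is equivalent to a superadditive function but $f$ is not, then $\Delta_{A'\wr B'}^{A\wr B}(n)\preceq\max(n f(n),g(n))$; - if neither $f$ nor $g$ is equivalent to a superadditive function, then $\Delta_{A'\wr B'}^{A\wr B}(n)\preceq\max(n f(n),n\,g(n))$.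
   Context: For a finitely generated group $G$ with a fixed finite generating set, $\lVert\cdot\rVert_G$ is the word length. For a finitely generated subgroup $H<G$ with its own fixed finite generating set, $\Delta_H^G(n)=\max\{\lVert h\rVert_H: h\in H,\ \lVert h\rVert_G\le n\}$. Distortion functions are considered up to multiplicative and additive constants: $u\preceq v$ means there are constants $C>0$, $D\ge0$ with $u(n)\le Cv(n)+D$ for all $n$; $u\sim v$ (equivalent) means $u\preceq v$ and $v\preceq u$. A function $f:\mathbb{N}\to\mathbb{N}$ is superadditive if $f(x+y)\ge f(x)+f(y)$ for all $x,y\in\mathbb{N}$. $A\wr B=\left(\bigoplus_{b\in B}A_b\right)\rtimes B$ is the restricted regular wreath product, with $B$ permuting the indices by left multiplication. $A'\wr B'$ is viewed as the subgroup of $A\wr B$ generated by $A'$ (in the copy of $A$ at index $1_B$) and $B'$.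
   Formalization: The word length on A≀B is taken with respect to the union of the chosen generating sets of A (at index 1_B) and B; with an unrelated generating set of A≀B the claim can fail for exponential distortion, since the equivalence allows no rescaling of n. *)

theory Defs
  imports Complex_Main "HOL-Algebra.Algebra"
begin

section \<open>Word length and distortion\<close>

definition generating_set :: "('a, 'm) monoid_scheme \<Rightarrow> 'a set \<Rightarrow> bool" where
  "generating_set G S \<longleftrightarrow> finite S \<and> S \<subseteq> carrier G \<and> generate G S = carrier G"

definition word_length :: "('a, 'm) monoid_scheme \<Rightarrow> 'a set \<Rightarrow> 'a \<Rightarrow> nat" where
  "word_length G S g =
     (LEAST n. \<exists>ws. length ws = n \<and> set ws \<subseteq> S \<union> m_inv G ` S \<and> foldr (\<otimes>\<^bsub>G\<^esub>) ws \<one>\<^bsub>G\<^esub> = g)"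

text \<open>
  Distortion of the subgroup \<open>H\<close>, generated by \<open>T\<close>, in the group \<open>G\<close>, generated by \<open>S\<close>.
  The maximum ranges over a nonempty set (it contains the length of the identity), which is
  finite because \<open>S\<close> is.
\<close>

definition distortion ::
  "('a, 'm) monoid_scheme \<Rightarrow> 'a set \<Rightarrow> 'a set \<Rightarrow> 'a set \<Rightarrow> nat \<Rightarrow> nat" where
  "distortion G S H T n =
     Max {word_length (G\<lparr>carrier := H\<rparr>) T h | h. h \<in> H \<and> word_length G S h \<le> n}"


section \<open>Comparison of functions\<close>

text \<open>
  The argument is not rescaled, so the class of a distortion function may depend on the generating
  set of the ambient group (for instance when the distortion is exponential), but does not
  depend on that of the subgroup.
\<close>

definition preceq :: "(nat \<Rightarrow> nat) \<Rightarrow> (nat \<Rightarrow> nat) \<Rightarrow> bool"  (infix "\<preceq>" 50) where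
  "u \<preceq> v \<longleftrightarrow> (\<exists>C D :: real. C > 0 \<and> D \<ge> 0 \<and> (\<forall>n. real (u n) \<le> C * real (v n) + D))"

definition equivalent :: "(nat \<Rightarrow> nat) \<Rightarrow> (nat \<Rightarrow> nat) \<Rightarrow> bool"  (infix "\<asymp>" 50) where
  "u \<asymp> v \<longleftrightarrow> u \<preceq> v \<and> v \<preceq> u"

definition superadditive :: "(nat \<Rightarrow> nat) \<Rightarrow> bool" where
  "superadditive f \<longleftrightarrow> (\<forall>x y. f (x + y) \<ge> f x + f y)"

definition equiv_superadditive :: "(nat \<Rightarrow> nat) \<Rightarrow> bool" where
  "equiv_superadditive f \<longleftrightarrow> (\<exists>F. superadditive F \<and> f \<asymp> F)"


section \<open>Wreath products\<close>

definition semidirect ::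
  "('n, 'k) monoid_scheme \<Rightarrow> ('b, 'm) monoid_scheme \<Rightarrow> ('b \<Rightarrow> 'n \<Rightarrow> 'n) \<Rightarrow> ('n \<times> 'b) monoid" where
  "semidirect N B \<alpha> =
     \<lparr>carrier = carrier N \<times> carrier B,
      monoid.mult = (\<lambda>(x, b) (y, c). (x \<otimes>\<^bsub>N\<^esub> \<alpha> b y, b \<otimes>\<^bsub>B\<^esub> c)),
      one = (\<one>\<^bsub>N\<^esub>, \<one>\<^bsub>B\<^esub>)\<rparr>"

text \<open>
  Left multiplication by \<open>b\<close> moves the entry at index \<open>x\<close> to index \<open>b x\<close>, so the entry of the
  translate at \<open>x\<close> is the old entry at \<open>b\<^sup>-\<^sup>1 x\<close>.
\<close>

definition translate :: "('b, 'm) monoid_scheme \<Rightarrow> 'b \<Rightarrow> ('b \<Rightarrow> 'a) \<Rightarrow> ('b \<Rightarrow> 'a)" where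
  "translate B b \<phi> = (\<lambda>x\<in>carrier B. \<phi> (inv\<^bsub>B\<^esub> b \<otimes>\<^bsub>B\<^esub> x))"

definition wreath ::
  "('a, 'k) monoid_scheme \<Rightarrow> ('b, 'm) monoid_scheme \<Rightarrow> (('b \<Rightarrow> 'a) \<times> 'b) monoid" where
  "wreath A B = semidirect (sum_group (carrier B) (\<lambda>_. A)) B (translate B)"

definition wreath_left ::
  "('a, 'k) monoid_scheme \<Rightarrow> ('b, 'm) monoid_scheme \<Rightarrow> 'a \<Rightarrow> ('b \<Rightarrow> 'a) \<times> 'b" where
  "wreath_left A B a = ((\<lambda>x\<in>carrier B. if x = \<one>\<^bsub>B\<^esub> then a else \<one>\<^bsub>A\<^esub>), \<one>\<^bsub>B\<^esub>)"

definition wreath_right ::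
  "('a, 'k) monoid_scheme \<Rightarrow> ('b, 'm) monoid_scheme \<Rightarrow> 'b \<Rightarrow> ('b \<Rightarrow> 'a) \<times> 'b" where
  "wreath_right A B b = ((\<lambda>x\<in>carrier B. \<one>\<^bsub>A\<^esub>), b)"

text \<open>
  The subset of \<open>A \<wr> B\<close> formed by \<open>U \<subseteq> A\<close>, placed at the index \<open>1\<close>, together with \<open>V \<subseteq> B\<close>.
  For generating sets \<open>U\<close> and \<open>V\<close> this is the standard generating set of \<open>A \<wr> B\<close>.
\<close>

definition wreath_union ::
  "('a, 'k) monoid_scheme \<Rightarrow> ('b, 'm) monoid_scheme \<Rightarrow> 'a set \<Rightarrow> 'b set \<Rightarrow> (('b \<Rightarrow> 'a) \<times> 'b) set"
  where
  "wreath_union A B U V = wreath_left A B ` U \<union> wreath_right A B ` V"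

definition wreath_sub ::
  "('a, 'k) monoid_scheme \<Rightarrow> ('b, 'm) monoid_scheme \<Rightarrow> 'a set \<Rightarrow> 'b set \<Rightarrow> (('b \<Rightarrow> 'a) \<times> 'b) set"
  where
  "wreath_sub A B H K = generate (wreath A B) (wreath_union A B H K)"

end

theory Submission
  imports Defs
begin

text \<open>
  Let \<open>(\<phi>, b)\<close> be an element of \<open>A' \<wr> B'\<close>, so \<open>\<phi>\<close> is supported in \<open>B'\<close> and has values in
  \<open>A'\<close>. Its length in a wreath product is governed by two costs: the sum of the lengths of the
  entries \<open>\<phi> x\<close>, and the length of a tour from \<open>1\<close> through the support to \<open>b\<close>.

  For the upper bounds, a word of length \<open>n\<close> over the generators of \<open>A \<wr> B\<close> yields a tour
  through at most \<open>n\<close> points with both costs, measured in \<open>A\<close> and \<open>B\<close>, at most \<open>n\<close>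
  (\<open>support_tour\<close>). All points of the support, and so all steps between them, lie in \<open>B'\<close>, and
  the same tour is now performed inside \<open>A' \<wr> B'\<close> (\<open>len_H_le_tour\<close>). Up to a
  constant factor, an entry of length \<open>k\<close> in \<open>A\<close> then costs at most \<open>f k\<close>, and a step of
  length \<open>k\<close> in \<open>B\<close> at most \<open>g k\<close>. What
  remains is to bound \<open>f k\<^sub>1 + \<dots> + f k\<^sub>r\<close> when \<open>k\<^sub>1 + \<dots> + k\<^sub>r \<le> n\<close> and \<open>r \<le> n + 1\<close>: a
  function equivalent to a superadditive one gives a multiple of \<open>f n\<close> and an error of order
  \<open>n\<close>, and monotonicity alone gives about \<open>n f n\<close> (\<open>equiv_superadditive_sum_bound\<close>, \<open>mono_sum_bound\<close>). The linear error is
  absorbed, because the distortion of an infinite subgroup is at least linear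
  (\<open>identity_preceq_distortion\<close>); if \<open>A'\<close> and \<open>B'\<close> are both finite, then so is
  \<open>A' \<wr> B'\<close> and its distortion is bounded.

  For the lower bound, an element of \<open>A'\<close> or \<open>B'\<close> is at most as long in \<open>A \<wr> B\<close> as in
  \<open>A\<close> or \<open>B\<close>. Conversely the length in \<open>A' \<wr> B'\<close> controls, up to a factor, the length of
  \<open>b\<close> in \<open>B'\<close>, since \<open>(\<phi>, b) \<mapsto> b\<close> is a homomorphism, and the length of each entry in \<open>A'\<close>,
  since a generator multiplies each entry by an element of bounded length
  (\<open>entry_le_len_H\<close>). Hence \<open>f\<close> and \<open>g\<close> are each dominated by the distortion of
  \<open>A' \<wr> B'\<close>.
\<close>

section \<open>Comparison of functions\<close>

lemma preceqI:
  assumes "\<And>n. u n \<le> C * v n + D"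
  shows "u \<preceq> v"
proof -
  have "real (u n) \<le> real (Suc C) * real (v n) + real D" for n
  proof -
    have "u n \<le> Suc C * v n + D" using assms[of n] by simp
    then show ?thesis by (metis of_nat_add of_nat_le_iff of_nat_mult)
  qed
  then show ?thesis unfolding preceq_def
    by (intro exI[of _ "real (Suc C)"] exI[of _ "real D"]) simp
qed

lemma preceqE:
  assumes "u \<preceq> v"
  obtains C D :: real where "C > 0" "D \<ge> 0" "\<And>n. real (u n) \<le> C * real (v n) + D"
  using assms unfolding preceq_def by blast

lemma preceq_trans:
  assumes "u \<preceq> v" "v \<preceq> w"
  shows "u \<preceq> w"
proof -
  obtain C D :: real where CD: "C > 0" "D \<ge> 0" "\<And>n. real (u n) \<le> C * real (v n) + D"
    using assms(1) by (rule preceqE) blast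
  obtain C' D' :: real where CD': "C' > 0" "D' \<ge> 0" "\<And>n. real (v n) \<le> C' * real (w n) + D'"
    using assms(2) by (rule preceqE) blast
  have "real (u n) \<le> (C * C') * real (w n) + (C * D' + D)" for n
    using CD(3)[of n] mult_left_mono[OF CD'(3)[of n], of C] CD(1) by (simp add: algebra_simps)
  then show ?thesis unfolding preceq_def using CD CD'
    by (intro exI[of _ "C * C'"] exI[of _ "C * D' + D"]) simp
qed

lemma preceq_add:
  assumes "u \<preceq> w" "v \<preceq> w"
  shows "(\<lambda>n. u n + v n) \<preceq> w"
proof -
  obtain C D :: real where CD: "C > 0" "D \<ge> 0" "\<And>n. real (u n) \<le> C * real (w n) + D"
    using assms(1) by (rule preceqE) blast
  obtain C' D' :: real where CD': "C' > 0" "D' \<ge> 0" "\<And>n. real (v n) \<le> C' * real (w n) + D'"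
    using assms(2) by (rule preceqE) blast
  have "real (u n + v n) \<le> (C + C') * real (w n) + (D + D')" for n
    using CD(3)[of n] CD'(3)[of n] by (simp add: algebra_simps)
  then show ?thesis unfolding preceq_def using CD CD'
    by (intro exI[of _ "C + C'"] exI[of _ "D + D'"]) simp
qed

lemma preceq_times_argument: "f \<preceq> (\<lambda>n. n * f n)"
proof (rule preceqI)
  fix n show "f n \<le> 1 * (n * f n) + f 0" by (cases n) auto
qed

lemma preceq_refl: "f \<preceq> f"
  by (rule preceqI[of _ 1 _ 0]) simp

section \<open>Word length\<close>

context group
begin

lemma foldr_mult_closed:
  "set ws \<subseteq> carrier G \<Longrightarrow> foldr (\<otimes>) ws \<one> \<in> carrier G"
  by (induction ws) auto

lemma foldr_mult_append:
  "set us \<subseteq> carrier G \<Longrightarrow> set vs \<subseteq> carrier G \<Longrightarrow>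
    foldr (\<otimes>) (us @ vs) \<one> = foldr (\<otimes>) us \<one> \<otimes> foldr (\<otimes>) vs \<one>"
  by (induction us) (auto simp: foldr_mult_closed m_assoc simp del: foldr_append)

lemma letters_closed: "S \<subseteq> carrier G \<Longrightarrow> S \<union> m_inv G ` S \<subseteq> carrier G"
  by auto

lemma generate_imp_word:
  assumes "S \<subseteq> carrier G" "g \<in> generate G S"
  shows "\<exists>ws. set ws \<subseteq> S \<union> m_inv G ` S \<and> foldr (\<otimes>) ws \<one> = g"
  using assms(2)
proof induction
  case one
  show ?case by (rule exI[of _ "[]"]) simp
next
  case (incl h)
  then show ?case using assms(1) by (intro exI[of _ "[h]"]) auto
next
  case (inv h)
  then show ?case using assms(1) by (intro exI[of _ "[inv h]"]) auto
next
  case (eng h1 h2)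
  then obtain us vs where "set us \<subseteq> S \<union> m_inv G ` S" "foldr (\<otimes>) us \<one> = h1"
    "set vs \<subseteq> S \<union> m_inv G ` S" "foldr (\<otimes>) vs \<one> = h2" by blast
  then show ?case
    using foldr_mult_append[of us vs] letters_closed[OF assms(1)]
    by (intro exI[of _ "us @ vs"]) (auto simp del: foldr_append)
qed

lemma word_length_le:
  "set ws \<subseteq> S \<union> m_inv G ` S \<Longrightarrow> word_length G S (foldr (\<otimes>) ws \<one>) \<le> length ws"
  unfolding word_length_def by (rule Least_le) blast

lemma word_length_one: "word_length G S \<one> = 0"
  using word_length_le[of "[]" S] by simp

lemma word_length_letter:
  assumes "S \<subseteq> carrier G" "s \<in> S \<union> m_inv G ` S"
  shows "word_length G S s \<le> 1"
  using word_length_le[of "[s]" S] letters_closed[OF assms(1)] assms(2)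
  by (auto dest: subsetD)

lemma geodesic_word:
  assumes "S \<subseteq> carrier G" "g \<in> generate G S"
  obtains ws where "set ws \<subseteq> S \<union> m_inv G ` S" "foldr (\<otimes>) ws \<one> = g"
    "length ws = word_length G S g"
proof -
  have "\<exists>n ws. length ws = n \<and> set ws \<subseteq> S \<union> m_inv G ` S \<and> foldr (\<otimes>) ws \<one> = g"
    using generate_imp_word[OF assms] by blast
  then have "\<exists>ws. length ws = word_length G S g \<and> set ws \<subseteq> S \<union> m_inv G ` S
      \<and> foldr (\<otimes>) ws \<one> = g"
    unfolding word_length_def by (rule LeastI_ex)
  then show ?thesis using that by blast
qed

lemma word_length_mult:
  assumes "S \<subseteq> carrier G" "g \<in> generate G S" "h \<in> generate G S"
  shows "word_length G S (g \<otimes> h) \<le> word_length G S g + word_length G S h"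
proof -
  note letters = letters_closed[OF assms(1)]
  obtain us vs where "set us \<subseteq> S \<union> m_inv G ` S" "foldr (\<otimes>) us \<one> = g"
    "length us = word_length G S g" "set vs \<subseteq> S \<union> m_inv G ` S" "foldr (\<otimes>) vs \<one> = h"
    "length vs = word_length G S h"
    using geodesic_word assms by metis
  then show ?thesis
    using foldr_mult_append[OF order_trans[OF _ letters] order_trans[OF _ letters], of us vs]
      word_length_le[of "us @ vs" S] by (simp del: foldr_append)
qed

text \<open>
  Bounds in terms of the word length arise by reading a shortest word from its last letter: the
  invariant \<open>R h m\<close> speaks of the product \<open>h\<close> of the last \<open>m\<close> letters.
\<close>

lemma word_length_induct [consumes 2, case_names one letter]:
  assumes "S \<subseteq> carrier G" "g \<in> generate G S"
    and "R \<one> 0"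
    and "\<And>s h m. s \<in> S \<union> m_inv G ` S \<Longrightarrow> h \<in> carrier G \<Longrightarrow> R h m \<Longrightarrow> R (s \<otimes> h) (Suc m)"
  shows "R g (word_length G S g)"
proof -
  obtain ws where ws: "set ws \<subseteq> S \<union> m_inv G ` S" "foldr (\<otimes>) ws \<one> = g"
    "length ws = word_length G S g"
    using geodesic_word assms(1,2) by metis
  have "R (foldr (\<otimes>) ws \<one>) (length ws)"
    using ws(1)
  proof (induction ws)
    case Nil
    show ?case using assms(3) by simp
  next
    case (Cons s ws)
    have "foldr (\<otimes>) ws \<one> \<in> carrier G"
      using Cons.prems letters_closed[OF assms(1)] by (intro foldr_mult_closed) auto
    then show ?case using Cons assms(4) by simp
  qed
  then show ?thesis using ws by simp
qed

lemma finite_word_ball: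
  assumes "S \<subseteq> carrier G" "finite S"
  shows "finite {g \<in> generate G S. word_length G S g \<le> n}"
proof -
  have "{g \<in> generate G S. word_length G S g \<le> n}
      \<subseteq> (\<lambda>ws. foldr (\<otimes>) ws \<one>) ` {ws. set ws \<subseteq> S \<union> m_inv G ` S \<and> length ws \<le> n}"
  proof
    fix g assume "g \<in> {g \<in> generate G S. word_length G S g \<le> n}"
    moreover then obtain ws where "set ws \<subseteq> S \<union> m_inv G ` S" "foldr (\<otimes>) ws \<one> = g"
      "length ws = word_length G S g"
      using geodesic_word assms(1) by (metis (mono_tags, lifting) mem_Collect_eq)
    ultimately show "g \<in> (\<lambda>ws. foldr (\<otimes>) ws \<one>) `
        {ws. set ws \<subseteq> S \<union> m_inv G ` S \<and> length ws \<le> n}" by force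
  qed
  moreover have "finite {ws. set ws \<subseteq> S \<union> m_inv G ` S \<and> length ws \<le> n}"
    using assms(2) by (intro finite_lists_length_le) auto
  ultimately show ?thesis by (meson finite_imageI finite_subset)
qed

end

text \<open>
  Homomorphisms are Lipschitz for the word metrics. The target metric lives on the subgroup
  generated by \<open>S'\<close>, so inclusions into an ambient group are covered as well.
\<close>

lemma hom_length_le:
  assumes "group G" "group G'" "h \<in> hom G G'"
    and S: "S \<subseteq> carrier G" "generate G S = carrier G"
    and S': "S' \<subseteq> carrier G'" "h ` carrier G \<subseteq> generate G' S'"
    and K: "\<And>s. s \<in> S \<union> m_inv G ` S \<Longrightarrow> word_length G' S' (h s) \<le> K"
    and g: "g \<in> carrier G"
  shows "word_length G' S' (h g) \<le> K * word_length G S g"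
proof -
  interpret G: group G by fact
  interpret G': group G' by fact
  show ?thesis
  proof (rule G.word_length_induct[of S g "\<lambda>g m. word_length G' S' (h g) \<le> K * m"])
    show "word_length G' S' (h \<one>\<^bsub>G\<^esub>) \<le> K * 0"
      using hom_one[OF assms(3,1,2)] G'.word_length_one by simp
  next
    fix s x m
    assume s: "s \<in> S \<union> m_inv G ` S" and x: "x \<in> carrier G"
      and IH: "word_length G' S' (h x) \<le> K * m"
    have sG: "s \<in> carrier G" using s G.letters_closed[OF S(1)] by auto
    then have "word_length G' S' (h s \<otimes>\<^bsub>G'\<^esub> h x) \<le> word_length G' S' (h s) + word_length G' S' (h x)"
      using x S' by (intro G'.word_length_mult) auto
    then show "word_length G' S' (h (s \<otimes>\<^bsub>G\<^esub> x)) \<le> K * Suc m"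
      using K[OF s] IH hom_mult[OF assms(3) sG x] by simp
  qed (use S g in auto)
qed

lemma hom_lipschitz:
  assumes "group G" "group G'" "h \<in> hom G G'"
    and S: "finite S" "S \<subseteq> carrier G" "generate G S = carrier G"
    and S': "S' \<subseteq> carrier G'" "h ` carrier G \<subseteq> generate G' S'"
  shows "\<exists>K>0. \<forall>g\<in>carrier G. word_length G' S' (h g) \<le> K * word_length G S g"
proof -
  define K where "K = Suc (Max (insert 0 ((\<lambda>s. word_length G' S' (h s)) ` (S \<union> m_inv G ` S))))"
  have "word_length G' S' (h s) \<le> K" if "s \<in> S \<union> m_inv G ` S" for s
    using that S(1) unfolding K_def by (intro le_SucI Max_ge) auto
  then have "word_length G' S' (h g) \<le> K * word_length G S g" if "g \<in> carrier G" for g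
    using that by (intro hom_length_le[OF assms(1-3) S(2,3) S']) auto
  then show ?thesis by (intro exI[of _ K]) (simp add: K_def)
qed

section \<open>Distortion\<close>

lemma (in group) distortion_finite:
  assumes "finite S" "S \<subseteq> carrier G" "H \<subseteq> generate G S"
  shows "finite {word_length (G\<lparr>carrier := H\<rparr>) T h | h. h \<in> H \<and> word_length G S h \<le> n}"
proof -
  have "{h \<in> H. word_length G S h \<le> n} \<subseteq> {g \<in> generate G S. word_length G S g \<le> n}"
    using assms(3) by auto
  then have "finite {h \<in> H. word_length G S h \<le> n}"
    using finite_word_ball[OF assms(2,1)] finite_subset by blast
  moreover have "{word_length (G\<lparr>carrier := H\<rparr>) T h | h. h \<in> H \<and> word_length G S h \<le> n}
      = word_length (G\<lparr>carrier := H\<rparr>) T ` {h \<in> H. word_length G S h \<le> n}" by auto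
  ultimately show ?thesis by simp
qed

lemma (in group) word_length_le_distortion:
  assumes "finite S" "S \<subseteq> carrier G" "H \<subseteq> generate G S"
    and "h \<in> H" "word_length G S h \<le> n"
  shows "word_length (G\<lparr>carrier := H\<rparr>) T h \<le> distortion G S H T n"
  unfolding distortion_def
  by (rule Max_ge[OF distortion_finite[OF assms(1-3)]]) (use assms(4,5) in blast)

lemma (in group) distortion_attained:
  assumes "finite S" "S \<subseteq> carrier G" "H \<subseteq> generate G S" "\<one> \<in> H"
  obtains h where "h \<in> H" "word_length G S h \<le> n"
    "word_length (G\<lparr>carrier := H\<rparr>) T h = distortion G S H T n"
proof -
  have "{word_length (G\<lparr>carrier := H\<rparr>) T h | h. h \<in> H \<and> word_length G S h \<le> n} \<noteq> {}"
    using assms(4) word_length_one[of S] by (auto intro!: exI[of _ \<one>])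
  from Max_in[OF distortion_finite[OF assms(1-3)] this] show ?thesis
    using that unfolding distortion_def by fastforce
qed

lemma (in group) distortion_mono:
  assumes "finite S" "S \<subseteq> carrier G" "H \<subseteq> generate G S" "\<one> \<in> H"
  shows "mono (distortion G S H T)"
proof (rule monoI)
  fix m n :: nat assume "m \<le> n"
  obtain h where h: "h \<in> H" "word_length G S h \<le> m"
    "word_length (G\<lparr>carrier := H\<rparr>) T h = distortion G S H T m"
    by (rule distortion_attained[OF assms])
  then show "distortion G S H T m \<le> distortion G S H T n"
    using word_length_le_distortion[OF assms(1-3) h(1), of n T] \<open>m \<le> n\<close> by simp
qed

text \<open>
  Balls are finite, so \<open>H\<close> has arbitrarily long elements. The prefix with \<open>m\<close> letters of a
  shortest word for such an element has length \<open>m\<close> in \<open>H\<close>; being a product of \<open>m\<close>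
  generators of \<open>H\<close>, it has length at most \<open>c m\<close> in \<open>G\<close>.
\<close>

lemma (in group) identity_preceq_distortion:
  assumes "finite S" "S \<subseteq> carrier G" "H \<subseteq> generate G S" "subgroup H G"
    and T: "generating_set (G\<lparr>carrier := H\<rparr>) T" and "infinite H"
  shows "(\<lambda>n. n) \<preceq> distortion G S H T"
proof -
  let ?H = "G\<lparr>carrier := H\<rparr>"
  interpret H: group ?H by (rule subgroup.subgroup_is_group[OF assms(4) is_group])
  have fin: "finite T" and TH: "T \<subseteq> carrier ?H" and gen: "generate ?H T = carrier ?H"
    using T by (auto simp: generating_set_def)
  let ?L = "T \<union> m_inv ?H ` T"
  have L: "?L \<subseteq> H" using H.letters_closed[OF TH] by simp
  have "(\<lambda>h. h) \<in> hom ?H G" using subgroup.subset[OF assms(4)] by (auto intro!: homI)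
  then obtain c where "c > 0" and c: "\<And>h. h \<in> H \<Longrightarrow> word_length G S h \<le> c * word_length ?H T h"
    using hom_lipschitz[OF H.is_group is_group, of "\<lambda>h. h" T S] fin TH gen assms(2,3) by auto
  have prefix: "\<exists>h\<in>H. m \<le> word_length ?H T h \<and> word_length G S h \<le> c * m" for m
  proof -
    have "\<not> H \<subseteq> {g \<in> generate ?H T. word_length ?H T g \<le> m}"
      using assms(6) H.finite_word_ball[OF TH fin] finite_subset by blast
    then obtain h where h: "h \<in> H" "word_length ?H T h > m"
      using gen by (auto simp: subset_iff not_le)
    then obtain ws where ws: "set ws \<subseteq> ?L" "foldr (\<otimes>\<^bsub>?H\<^esub>) ws \<one>\<^bsub>?H\<^esub> = h"
      "length ws = word_length ?H T h"
      using H.geodesic_word[OF TH, of h] gen by auto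
    let ?u = "foldr (\<otimes>\<^bsub>?H\<^esub>) (take m ws) \<one>\<^bsub>?H\<^esub>" and ?v = "foldr (\<otimes>\<^bsub>?H\<^esub>) (drop m ws) \<one>\<^bsub>?H\<^esub>"
    have sets: "set (take m ws) \<subseteq> ?L" "set (drop m ws) \<subseteq> ?L"
      using ws(1) set_take_subset[of m ws] set_drop_subset[of m ws] by blast+
    have in_H: "set (take m ws) \<subseteq> carrier ?H" "set (drop m ws) \<subseteq> carrier ?H"
      using order_trans[OF sets(1) L] order_trans[OF sets(2) L] by simp_all
    note uv = H.foldr_mult_closed[OF in_H(1)] H.foldr_mult_closed[OF in_H(2)]
    have "h = ?u \<otimes>\<^bsub>?H\<^esub> ?v"
      using ws(2) H.foldr_mult_append[OF in_H] by (simp only: append_take_drop_id)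
    then have "word_length ?H T h \<le> word_length ?H T ?u + word_length ?H T ?v"
      using H.word_length_mult[OF TH, of ?u ?v] gen uv by simp
    moreover have "word_length ?H T ?v \<le> length ws - m"
      using H.word_length_le[OF sets(2)] by simp
    ultimately have "m \<le> word_length ?H T ?u" using h ws(3) by linarith
    moreover have "word_length ?H T ?u \<le> m"
      using H.word_length_le[OF sets(1)] by simp
    moreover have "word_length G S ?u \<le> c * word_length ?H T ?u"
      using uv(1) by (intro c) simp
    ultimately show ?thesis using uv(1)
      by (intro bexI[of _ ?u] conjI) (auto intro: order_trans)
  qed
  show ?thesis
  proof (rule preceqI)
    fix n
    obtain h where h: "h \<in> H" "n div c \<le> word_length ?H T h" "word_length G S h \<le> c * (n div c)"
      using prefix by blast
    then have "n div c \<le> distortion G S H T n"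
      using word_length_le_distortion[OF assms(1-3) h(1), of n T]
      by (meson le_trans times_div_less_eq_dividend)
    then have "c * (n div c) \<le> c * distortion G S H T n" by simp
    moreover have "n \<le> c * (n div c) + c"
      using \<open>c > 0\<close> mult_div_mod_eq[of c n] mod_less_divisor[of c n] by linarith
    ultimately show "n \<le> c * distortion G S H T n + c" by linarith
  qed
qed

section \<open>Sums of values of a function\<close>

text \<open>
  The summands are the lengths of the entries of an element of length \<open>n\<close>, or of the steps of
  its tour; a tour through \<open>n\<close> points has \<open>n + 1\<close> steps. The error term is linear because
  the additive constant in \<open>f \<asymp> F\<close> is paid once for each summand.
\<close>

definition sum_bound :: "(nat \<Rightarrow> nat) \<Rightarrow> (nat \<Rightarrow> nat) \<Rightarrow> bool" where
  "sum_bound f p \<longleftrightarrow> (\<exists>C D :: real. C \<ge> 0 \<and> D \<ge> 0 \<and>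
    (\<forall>ns n. sum_list ns \<le> n \<longrightarrow> length ns \<le> n + 1 \<longrightarrow>
      real (sum_list (map f ns)) \<le> C * real (p n) + D * (real n + 1)))"

lemma superadditive_sum_list:
  assumes "superadditive F"
  shows "sum_list (map F ns) \<le> F (sum_list ns)"
proof (induction ns)
  case (Cons n ns)
  then show ?case using assms unfolding superadditive_def
    by (simp add: order_trans[OF add_left_mono])
qed simp

lemma superadditive_mono:
  assumes "superadditive F" shows "mono F"
proof (rule monoI)
  fix m n :: nat assume "m \<le> n"
  then have "F n \<ge> F m + F (n - m)"
    using assms unfolding superadditive_def by (metis le_add_diff_inverse)
  then show "F m \<le> F n" by simp
qed

lemma equiv_superadditive_sum_bound:
  assumes "equiv_superadditive f"
  shows "sum_bound f f"
proof -
  obtain F where F: "superadditive F" "f \<preceq> F" "F \<preceq> f"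
    using assms unfolding equiv_superadditive_def equivalent_def by blast
  obtain C D :: real where CD: "C > 0" "D \<ge> 0" "\<And>n. real (f n) \<le> C * real (F n) + D"
    using F(2) unfolding preceq_def by blast
  obtain C' D' :: real where CD': "C' > 0" "D' \<ge> 0" "\<And>n. real (F n) \<le> C' * real (f n) + D'"
    using F(3) unfolding preceq_def by blast
  have termwise: "real (sum_list (map f ns)) \<le> C * real (sum_list (map F ns)) + D * length ns"
    for ns
  proof (induction ns)
    case (Cons n ns)
    then show ?case using CD(3)[of n] by (simp add: algebra_simps)
  qed simp
  have "real (sum_list (map f ns)) \<le> (C * C') * real (f n) + (C * D' + D) * (real n + 1)"
    if "sum_list ns \<le> n" "length ns \<le> n + 1" for ns n
  proof -
    have "sum_list (map F ns) \<le> F n"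
      using superadditive_sum_list[OF F(1)] superadditive_mono[OF F(1)] that(1)
      by (meson le_trans monoD)
    then have "C * real (sum_list (map F ns)) \<le> C * (C' * real (f n) + D')"
      using CD(1) CD'(3)[of n] by (intro mult_left_mono) linarith+
    moreover have "D * length ns \<le> D * (real n + 1)"
      using CD(2) that(2) by (intro mult_left_mono) auto
    moreover have "C * D' \<le> (C * D') * (real n + 1)"
      using CD(1) CD'(2) by (simp add: algebra_simps)
    ultimately show ?thesis using termwise[of ns] by (simp add: algebra_simps)
  qed
  moreover have "C * C' \<ge> 0" "C * D' + D \<ge> 0" using CD CD' by simp_all
  ultimately show ?thesis unfolding sum_bound_def by blast
qed

text \<open>
  Each of the at most \<open>n + 1\<close> summands is at most \<open>f n\<close>, and \<open>(n + 1) f n \<le> 2 n f n\<close> except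
  at \<open>n = 0\<close>, where the constant \<open>f 0\<close> takes over.
\<close>

lemma mono_sum_bound:
  assumes "mono f"
  shows "sum_bound f (\<lambda>n. n * f n)"
proof -
  have "real (sum_list (map f ns)) \<le> 2 * real (n * f n) + real (f 0) * (real n + 1)"
    if "sum_list ns \<le> n" "length ns \<le> n + 1" for ns n
  proof -
    have "sum_list (map f ns) \<le> sum_list (map (\<lambda>_. f n) ns)"
      by (intro sum_list_mono monoD[OF assms] order_trans[OF member_le_sum_list that(1)])
        simp_all
    also have "\<dots> \<le> (n + 1) * f n"
      using mult_right_mono[OF that(2), of "f n"] by (simp add: sum_list_triv)
    also have "\<dots> \<le> 2 * (n * f n) + f 0" by (cases n) auto
    finally have "real (sum_list (map f ns)) \<le> 2 * real (n * f n) + real (f 0)"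
      by (metis (mono_tags) of_nat_add of_nat_le_iff of_nat_mult of_nat_numeral)
    moreover have "real (f 0) \<le> real (f 0) * (real n + 1)" by (simp add: algebra_simps)
    ultimately show ?thesis by linarith
  qed
  then show ?thesis unfolding sum_bound_def
    by (intro exI[of _ 2] exI[of _ "real (f 0)"]) auto
qed

section \<open>The wreath product as a group\<close>

locale wreath_product = A: group A + B: group B
  for A :: "('a, 'k) monoid_scheme" and B :: "('b, 'm) monoid_scheme"
begin

abbreviation W :: "(('b \<Rightarrow> 'a) \<times> 'b) monoid" where "W \<equiv> wreath A B"

lemma carrier_wreath:
  "(\<phi>, b) \<in> carrier W \<longleftrightarrow>
    \<phi> \<in> carrier B \<rightarrow>\<^sub>E carrier A \<and> finite {x \<in> carrier B. \<phi> x \<noteq> \<one>\<^bsub>A\<^esub>} \<and> b \<in> carrier B"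
  by (auto simp: wreath_def semidirect_def carrier_sum_group)

lemma wreath_closed:
  assumes "(\<phi>, b) \<in> carrier W" "x \<in> carrier B" shows "\<phi> x \<in> carrier A"
  using assms unfolding carrier_wreath by auto

lemma mult_wreath:
  "(\<phi>, b) \<otimes>\<^bsub>W\<^esub> (\<psi>, c) =
    ((\<lambda>x\<in>carrier B. \<phi> x \<otimes>\<^bsub>A\<^esub> \<psi> (inv\<^bsub>B\<^esub> b \<otimes>\<^bsub>B\<^esub> x)), b \<otimes>\<^bsub>B\<^esub> c)"
  by (auto simp: wreath_def semidirect_def translate_def)

lemma one_wreath: "\<one>\<^bsub>W\<^esub> = ((\<lambda>x\<in>carrier B. \<one>\<^bsub>A\<^esub>), \<one>\<^bsub>B\<^esub>)"
  by (simp add: wreath_def semidirect_def)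

lemma cancel_left:
  assumes "x \<in> carrier B" "y \<in> carrier B"
  shows "inv\<^bsub>B\<^esub> x \<otimes>\<^bsub>B\<^esub> (x \<otimes>\<^bsub>B\<^esub> y) = y" "x \<otimes>\<^bsub>B\<^esub> (inv\<^bsub>B\<^esub> x \<otimes>\<^bsub>B\<^esub> y) = y"
  using assms by (simp_all add: B.m_assoc[symmetric])

lemma translate_support_finite:
  assumes "finite {x \<in> carrier B. \<psi> x \<noteq> \<one>\<^bsub>A\<^esub>}" "b \<in> carrier B"
  shows "finite {x \<in> carrier B. \<psi> (inv\<^bsub>B\<^esub> b \<otimes>\<^bsub>B\<^esub> x) \<noteq> \<one>\<^bsub>A\<^esub>}"
proof (rule finite_subset)
  show "{x \<in> carrier B. \<psi> (inv\<^bsub>B\<^esub> b \<otimes>\<^bsub>B\<^esub> x) \<noteq> \<one>\<^bsub>A\<^esub>}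
      \<subseteq> (\<lambda>y. b \<otimes>\<^bsub>B\<^esub> y) ` {x \<in> carrier B. \<psi> x \<noteq> \<one>\<^bsub>A\<^esub>}"
  proof
    fix x assume "x \<in> {x \<in> carrier B. \<psi> (inv\<^bsub>B\<^esub> b \<otimes>\<^bsub>B\<^esub> x) \<noteq> \<one>\<^bsub>A\<^esub>}"
    then show "x \<in> (\<lambda>y. b \<otimes>\<^bsub>B\<^esub> y) ` {x \<in> carrier B. \<psi> x \<noteq> \<one>\<^bsub>A\<^esub>}"
      using assms(2) by (intro image_eqI[of _ _ "inv\<^bsub>B\<^esub> b \<otimes>\<^bsub>B\<^esub> x"])
        (auto simp: cancel_left)
  qed
qed (use assms(1) in simp)

lemma wreath_group: "group W"
proof (rule groupI)
  fix v w assume v: "v \<in> carrier W" and w: "w \<in> carrier W"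
  obtain \<phi> b \<psi> c where vw: "v = (\<phi>, b)" "w = (\<psi>, c)" by (cases v, cases w)
  have "finite ({x \<in> carrier B. \<phi> x \<noteq> \<one>\<^bsub>A\<^esub>}
      \<union> {x \<in> carrier B. \<psi> (inv\<^bsub>B\<^esub> b \<otimes>\<^bsub>B\<^esub> x) \<noteq> \<one>\<^bsub>A\<^esub>})"
    using v w translate_support_finite[of \<psi> b] unfolding vw carrier_wreath by simp
  then have "finite {x \<in> carrier B. \<phi> x \<otimes>\<^bsub>A\<^esub> \<psi> (inv\<^bsub>B\<^esub> b \<otimes>\<^bsub>B\<^esub> x) \<noteq> \<one>\<^bsub>A\<^esub>}"
    by (rule rev_finite_subset) auto
  then show "v \<otimes>\<^bsub>W\<^esub> w \<in> carrier W"
    using v w unfolding vw mult_wreath carrier_wreath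
    by (auto simp: PiE_iff cong: conj_cong)
next
  show "\<one>\<^bsub>W\<^esub> \<in> carrier W"
    by (auto simp: one_wreath carrier_wreath cong: conj_cong)
next
  fix u v w assume u: "u \<in> carrier W" and v: "v \<in> carrier W" and w: "w \<in> carrier W"
  obtain \<phi> b \<psi> c \<xi> d where e: "u = (\<phi>, b)" "v = (\<psi>, c)" "w = (\<xi>, d)"
    by (cases u, cases v, cases w)
  show "u \<otimes>\<^bsub>W\<^esub> v \<otimes>\<^bsub>W\<^esub> w = u \<otimes>\<^bsub>W\<^esub> (v \<otimes>\<^bsub>W\<^esub> w)"
    using u v w unfolding e mult_wreath carrier_wreath
    by (auto simp: B.m_assoc B.inv_mult_group PiE_iff A.m_assoc intro!: restrict_ext)
next
  fix v assume v: "v \<in> carrier W"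
  obtain \<phi> b where e: "v = (\<phi>, b)" by (cases v)
  show "\<one>\<^bsub>W\<^esub> \<otimes>\<^bsub>W\<^esub> v = v"
    using v unfolding e mult_wreath carrier_wreath one_wreath
    by (auto simp: PiE_iff extensional_def fun_eq_iff)
  (* The inverse of (phi, b) inverts all entries and translates them back by b. *)
  let ?u = "(\<lambda>x\<in>carrier B. inv\<^bsub>A\<^esub> \<phi> (b \<otimes>\<^bsub>B\<^esub> x), inv\<^bsub>B\<^esub> b)"
  have "?u \<in> carrier W"
    using v translate_support_finite[of \<phi> "inv\<^bsub>B\<^esub> b"] unfolding e carrier_wreath
    by (auto simp: PiE_iff A.inv_eq_1_iff cong: conj_cong)
  moreover have "?u \<otimes>\<^bsub>W\<^esub> v = \<one>\<^bsub>W\<^esub>"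
    using v unfolding e mult_wreath carrier_wreath one_wreath
    by (auto simp: PiE_iff intro!: restrict_ext)
  ultimately show "\<exists>u\<in>carrier W. u \<otimes>\<^bsub>W\<^esub> v = \<one>\<^bsub>W\<^esub>" by blast
qed

sublocale W: group W by (rule wreath_group)

abbreviation left :: "'a \<Rightarrow> ('b \<Rightarrow> 'a) \<times> 'b" where "left \<equiv> wreath_left A B"
abbreviation right :: "'b \<Rightarrow> ('b \<Rightarrow> 'a) \<times> 'b" where "right \<equiv> wreath_right A B"

lemma left_closed: "a \<in> carrier A \<Longrightarrow> left a \<in> carrier W"
  by (auto simp: wreath_left_def carrier_wreath intro: finite_subset[of _ "{\<one>\<^bsub>B\<^esub>}"] split: if_splits)

lemma right_closed: "b \<in> carrier B \<Longrightarrow> right b \<in> carrier W"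
  by (auto simp: wreath_right_def carrier_wreath cong: conj_cong)

lemma left_mult:
  assumes "a \<in> carrier A" "(\<phi>, b) \<in> carrier W"
  shows "left a \<otimes>\<^bsub>W\<^esub> (\<phi>, b) = (\<phi>(\<one>\<^bsub>B\<^esub> := a \<otimes>\<^bsub>A\<^esub> \<phi> \<one>\<^bsub>B\<^esub>), b)"
  using assms unfolding carrier_wreath wreath_left_def mult_wreath
  by (auto simp: PiE_iff extensional_def fun_eq_iff)

lemma right_mult:
  assumes "c \<in> carrier B" "(\<phi>, b) \<in> carrier W"
  shows "right c \<otimes>\<^bsub>W\<^esub> (\<phi>, b) =
    ((\<lambda>x\<in>carrier B. \<phi> (inv\<^bsub>B\<^esub> c \<otimes>\<^bsub>B\<^esub> x)), c \<otimes>\<^bsub>B\<^esub> b)"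
  using assms unfolding carrier_wreath wreath_right_def mult_wreath
  by (auto simp: PiE_iff extensional_def fun_eq_iff)

lemma left_hom: "left \<in> hom A W"
proof (rule homI)
  fix a a' assume "a \<in> carrier A" "a' \<in> carrier A"
  then show "left (a \<otimes>\<^bsub>A\<^esub> a') = left a \<otimes>\<^bsub>W\<^esub> left a'"
    by (auto simp: wreath_left_def mult_wreath fun_eq_iff)
qed (rule left_closed)

lemma right_hom: "right \<in> hom B W"
proof (rule homI)
  fix b b' assume "b \<in> carrier B" "b' \<in> carrier B"
  then show "right (b \<otimes>\<^bsub>B\<^esub> b') = right b \<otimes>\<^bsub>W\<^esub> right b'"
    by (auto simp: wreath_right_def mult_wreath fun_eq_iff)
qed (rule right_closed)

lemma left_inv: "a \<in> carrier A \<Longrightarrow> inv\<^bsub>W\<^esub> left a = left (inv\<^bsub>A\<^esub> a)"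
  using group_hom.hom_inv[of A W left a] left_hom
  by (simp add: group_hom_def group_hom_axioms_def A.is_group wreath_group)

lemma right_inv: "b \<in> carrier B \<Longrightarrow> inv\<^bsub>W\<^esub> right b = right (inv\<^bsub>B\<^esub> b)"
  using group_hom.hom_inv[of B W right b] right_hom
  by (simp add: group_hom_def group_hom_axioms_def B.is_group wreath_group)

lemma left_one: "left \<one>\<^bsub>A\<^esub> = \<one>\<^bsub>W\<^esub>"
  by (auto simp: wreath_left_def one_wreath)

lemma right_one: "right \<one>\<^bsub>B\<^esub> = \<one>\<^bsub>W\<^esub>"
  by (auto simp: wreath_right_def one_wreath)

lemma wreath_union_closed:
  "U \<subseteq> carrier A \<Longrightarrow> V \<subseteq> carrier B \<Longrightarrow> wreath_union A B U V \<subseteq> carrier W"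
  by (auto simp: wreath_union_def left_closed right_closed)

lemma wreath_union_letters:
  assumes "U \<subseteq> carrier A" "V \<subseteq> carrier B"
  shows "wreath_union A B U V \<union> m_inv W ` wreath_union A B U V =
    wreath_union A B (U \<union> m_inv A ` U) (V \<union> m_inv B ` V)"
proof -
  have "m_inv W ` left ` U = left ` m_inv A ` U" "m_inv W ` right ` V = right ` m_inv B ` V"
    using assms by (auto simp: image_image left_inv right_inv subset_iff intro!: image_cong)
  then show ?thesis unfolding wreath_union_def image_Un by (simp only: Un_ac)
qed

lemma left_generate:
  assumes "U \<subseteq> carrier A" "a \<in> generate A U"
  shows "left a \<in> generate W (wreath_union A B U V)"
  using assms(2)
proof induction
  case one then show ?case by (simp add: left_one generate.one)
next
  case (incl h) then show ?case by (auto simp: wreath_union_def intro: generate.incl)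
next
  case (inv h)
  then have "left h \<in> wreath_union A B U V" "h \<in> carrier A"
    using assms(1) by (auto simp: wreath_union_def)
  then show ?case using generate.inv left_inv by metis
next
  case (eng h1 h2)
  then show ?case
    using hom_mult[OF left_hom] A.generate_in_carrier[OF assms(1)] by (auto intro: generate.eng)
qed

lemma right_generate:
  assumes "V \<subseteq> carrier B" "b \<in> generate B V"
  shows "right b \<in> generate W (wreath_union A B U V)"
  using assms(2)
proof induction
  case one then show ?case by (simp add: right_one generate.one)
next
  case (incl h) then show ?case by (auto simp: wreath_union_def intro: generate.incl)
next
  case (inv h)
  then have "right h \<in> wreath_union A B U V" "h \<in> carrier B"
    using assms(1) by (auto simp: wreath_union_def)
  then show ?case using generate.inv right_inv by metis
next
  case (eng h1 h2)
  then show ?case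
    using hom_mult[OF right_hom] B.generate_in_carrier[OF assms(1)] by (auto intro: generate.eng)
qed

section \<open>Tours of the support\<close>

fun steps :: "'b \<Rightarrow> 'b list \<Rightarrow> 'b \<Rightarrow> 'b list" where
  "steps c [] b = [inv\<^bsub>B\<^esub> c \<otimes>\<^bsub>B\<^esub> b]"
| "steps c (x # xs) b = (inv\<^bsub>B\<^esub> c \<otimes>\<^bsub>B\<^esub> x) # steps x xs b"

lemma length_steps [simp]: "length (steps c xs b) = length xs + 1"
  by (induction xs arbitrary: c) auto

lemma steps_closed:
  assumes "subgroup K B" "c \<in> K" "set xs \<subseteq> K" "b \<in> K"
  shows "set (steps c xs b) \<subseteq> K"
  using assms(2,3)
  by (induction xs arbitrary: c)
     (auto simp: assms subgroup.m_closed subgroup.m_inv_closed)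

lemma inv_mult_translate:
  assumes "v \<in> carrier B" "x \<in> carrier B" "y \<in> carrier B"
  shows "inv\<^bsub>B\<^esub> (v \<otimes>\<^bsub>B\<^esub> x) \<otimes>\<^bsub>B\<^esub> (v \<otimes>\<^bsub>B\<^esub> y) = inv\<^bsub>B\<^esub> x \<otimes>\<^bsub>B\<^esub> y"
  using assms by (simp add: B.inv_mult_group B.m_assoc cancel_left)

lemma steps_translate:
  assumes "v \<in> carrier B" "c \<in> carrier B" "set xs \<subseteq> carrier B" "b \<in> carrier B"
  shows "steps (v \<otimes>\<^bsub>B\<^esub> c) (map (\<lambda>x. v \<otimes>\<^bsub>B\<^esub> x) xs) (v \<otimes>\<^bsub>B\<^esub> b) = steps c xs b"
  using assms(2,3)
  by (induction xs arbitrary: c) (auto simp: assms inv_mult_translate)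

definition tour_length :: "'b set \<Rightarrow> 'b \<Rightarrow> 'b list \<Rightarrow> 'b \<Rightarrow> nat" where
  "tour_length S c xs b = sum_list (map (word_length B S) (steps c xs b))"

lemma tour_length_triangle:
  assumes "S \<subseteq> carrier B" "generate B S = carrier B"
    and "c \<in> carrier B" "p \<in> carrier B" "set xs \<subseteq> carrier B" "b \<in> carrier B"
  shows "tour_length S c xs b \<le> word_length B S (inv\<^bsub>B\<^esub> c \<otimes>\<^bsub>B\<^esub> p) + tour_length S p xs b"
proof -
  have tri: "word_length B S (inv\<^bsub>B\<^esub> c \<otimes>\<^bsub>B\<^esub> y)
      \<le> word_length B S (inv\<^bsub>B\<^esub> c \<otimes>\<^bsub>B\<^esub> p) + word_length B S (inv\<^bsub>B\<^esub> p \<otimes>\<^bsub>B\<^esub> y)"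
    if "y \<in> carrier B" for y
  proof -
    have "inv\<^bsub>B\<^esub> c \<otimes>\<^bsub>B\<^esub> y = (inv\<^bsub>B\<^esub> c \<otimes>\<^bsub>B\<^esub> p) \<otimes>\<^bsub>B\<^esub> (inv\<^bsub>B\<^esub> p \<otimes>\<^bsub>B\<^esub> y)"
      using assms that by (simp add: B.m_assoc cancel_left)
    then show ?thesis
      using B.word_length_mult[OF assms(1), of "inv\<^bsub>B\<^esub> c \<otimes>\<^bsub>B\<^esub> p" "inv\<^bsub>B\<^esub> p \<otimes>\<^bsub>B\<^esub> y"] assms that
      by simp
  qed
  show ?thesis
  proof (cases xs)
    case Nil
    then show ?thesis using tri[of b] assms by (simp add: tour_length_def)
  next
    case (Cons y ys)
    then show ?thesis using tri[of y] assms by (simp add: tour_length_def)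
  qed
qed

lemma tour_length_filter:
  assumes "S \<subseteq> carrier B" "generate B S = carrier B"
    and "c \<in> carrier B" "set xs \<subseteq> carrier B" "b \<in> carrier B"
  shows "tour_length S c (filter P xs) b \<le> tour_length S c xs b"
  using assms(3,4)
proof (induction xs arbitrary: c)
  case (Cons x xs)
  have IH: "tour_length S x (filter P xs) b \<le> tour_length S x xs b" using Cons by simp
  have "tour_length S c (filter P xs) b
      \<le> word_length B S (inv\<^bsub>B\<^esub> c \<otimes>\<^bsub>B\<^esub> x) + tour_length S x (filter P xs) b"
    using Cons.prems assms by (intro tour_length_triangle) auto
  then show ?case using IH by (auto simp: tour_length_def)
qed simp

text \<open>
  A word in the generators of \<open>A \<wr> B\<close> describes a walk in \<open>B\<close> that changes the entry at its
  current position. The letters of \<open>B\<close> pay for a tour through the sites where entries are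
  changed, and the letters of \<open>A\<close> for the lengths of the entries. The word is read from its last
  letter, so a letter of \<open>B\<close> translates the sites found so far, and a letter of \<open>A\<close> changes
  the entry at the starting point \<open>1\<close>, which costs no step when it becomes a new site.
\<close>

lemma support_tour:
  assumes U: "U \<subseteq> carrier A" "generate A U = carrier A"
    and V: "V \<subseteq> carrier B" "generate B V = carrier B"
    and w: "w \<in> generate W (wreath_union A B U V)"
  obtains xs where "distinct xs" "set xs \<subseteq> carrier B"
    "\<And>x. x \<in> carrier B \<Longrightarrow> fst w x \<noteq> \<one>\<^bsub>A\<^esub> \<Longrightarrow> x \<in> set xs"
    "length xs \<le> word_length W (wreath_union A B U V) w"
    "sum_list (map (\<lambda>x. word_length A U (fst w x)) xs) + tour_length V \<one>\<^bsub>B\<^esub> xs (snd w)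
      \<le> word_length W (wreath_union A B U V) w"
proof -
  define R where "R w m \<longleftrightarrow> (\<exists>xs. distinct xs \<and> set xs \<subseteq> carrier B \<and>
      (\<forall>x\<in>carrier B. fst w x \<noteq> \<one>\<^bsub>A\<^esub> \<longrightarrow> x \<in> set xs) \<and> length xs \<le> m \<and>
      sum_list (map (\<lambda>x. word_length A U (fst w x)) xs) + tour_length V \<one>\<^bsub>B\<^esub> xs (snd w) \<le> m)"
    for w and m :: nat
  have "R w (word_length W (wreath_union A B U V) w)"
    using wreath_union_closed[OF U(1) V(1)] w
  proof (induction rule: W.word_length_induct)
    case one
    show ?case unfolding R_def
      by (rule exI[of _ "[]"]) (simp add: one_wreath tour_length_def B.word_length_one)
  next
    case (letter s h m)
    obtain \<phi> b where h: "h = (\<phi>, b)" by (cases h)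
    have hW: "(\<phi>, b) \<in> carrier W" and b: "b \<in> carrier B"
      using letter(2) unfolding h by (auto simp: carrier_wreath)
    obtain xs where xs: "distinct xs" "set xs \<subseteq> carrier B"
      "\<And>x. x \<in> carrier B \<Longrightarrow> \<phi> x \<noteq> \<one>\<^bsub>A\<^esub> \<Longrightarrow> x \<in> set xs" "length xs \<le> m"
      "sum_list (map (\<lambda>x. word_length A U (\<phi> x)) xs) + tour_length V \<one>\<^bsub>B\<^esub> xs b \<le> m"
      using letter(3) unfolding R_def h by auto
    have "s \<in> left ` (U \<union> m_inv A ` U) \<union> right ` (V \<union> m_inv B ` V)"
      using letter(1) by (simp only: wreath_union_letters[OF U(1) V(1)]) (simp only: wreath_union_def)
    then consider (A) a where "a \<in> U \<union> m_inv A ` U" "s = left a"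
      | (B) v where "v \<in> V \<union> m_inv B ` V" "s = right v"
      by (elim UnE[of s "left ` _" "right ` _"] imageE[of s left] imageE[of s right]) simp_all
    then show ?case
    proof cases
      case A
      have a: "a \<in> carrier A" "word_length A U a \<le> 1"
        using A(1) A.letters_closed[OF U(1)] A.word_length_letter[OF U(1)] by auto
      let ?\<psi> = "\<phi>(\<one>\<^bsub>B\<^esub> := a \<otimes>\<^bsub>A\<^esub> \<phi> \<one>\<^bsub>B\<^esub>)"
      have sh: "s \<otimes>\<^bsub>W\<^esub> h = (?\<psi>, b)" using A(2) h left_mult[OF a(1) hW] by simp
      have at1: "word_length A U (a \<otimes>\<^bsub>A\<^esub> \<phi> \<one>\<^bsub>B\<^esub>) \<le> Suc (word_length A U (\<phi> \<one>\<^bsub>B\<^esub>))"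
        using A.word_length_mult[OF U(1), of a "\<phi> \<one>\<^bsub>B\<^esub>"] a wreath_closed[OF hW] U(2) by simp
      show ?thesis
      proof (cases "\<one>\<^bsub>B\<^esub> \<in> set xs")
        case True
        have "sum_list (map (\<lambda>x. word_length A U (?\<psi> x)) xs)
            = word_length A U (?\<psi> \<one>\<^bsub>B\<^esub>) + (\<Sum>x\<in>set xs - {\<one>\<^bsub>B\<^esub>}. word_length A U (?\<psi> x))"
          using True xs(1) by (simp only: sum_list_distinct_conv_sum_set sum.remove finite_set)
        also have "\<dots> = word_length A U (?\<psi> \<one>\<^bsub>B\<^esub>) + (\<Sum>x\<in>set xs - {\<one>\<^bsub>B\<^esub>}. word_length A U (\<phi> x))"
          by simp
        also have "\<dots> \<le> Suc (word_length A U (\<phi> \<one>\<^bsub>B\<^esub>)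
            + (\<Sum>x\<in>set xs - {\<one>\<^bsub>B\<^esub>}. word_length A U (\<phi> x)))"
          using at1 by simp
        also have "\<dots> = Suc (sum_list (map (\<lambda>x. word_length A U (\<phi> x)) xs))"
          using True xs(1) by (simp only: sum_list_distinct_conv_sum_set sum.remove finite_set)
        finally have "sum_list (map (\<lambda>x. word_length A U (?\<psi> x)) xs)
            \<le> Suc (sum_list (map (\<lambda>x. word_length A U (\<phi> x)) xs))" .
        then show ?thesis using xs True unfolding R_def sh by (intro exI[of _ xs]) auto
      next
        case False
        have "\<phi> \<one>\<^bsub>B\<^esub> = \<one>\<^bsub>A\<^esub>" using False xs(3)[of "\<one>\<^bsub>B\<^esub>"] by auto
        moreover have "sum_list (map (\<lambda>x. word_length A U (?\<psi> x)) xs)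
            = sum_list (map (\<lambda>x. word_length A U (\<phi> x)) xs)"
          using False by (intro arg_cong[of _ _ sum_list] map_cong) auto
        ultimately show ?thesis
          using xs False at1 A.word_length_one[of U] B.word_length_one[of V] unfolding R_def sh
          by (intro exI[of _ "\<one>\<^bsub>B\<^esub> # xs"]) (auto simp: tour_length_def)
      qed
    next
      case B
      have v: "v \<in> carrier B" "word_length B V v \<le> 1"
        using B(1) B.letters_closed[OF V(1)] B.word_length_letter[OF V(1)] by auto
      let ?\<psi> = "\<lambda>x\<in>carrier B. \<phi> (inv\<^bsub>B\<^esub> v \<otimes>\<^bsub>B\<^esub> x)"
      let ?ys = "map (\<lambda>x. v \<otimes>\<^bsub>B\<^esub> x) xs"
      have sh: "s \<otimes>\<^bsub>W\<^esub> h = (?\<psi>, v \<otimes>\<^bsub>B\<^esub> b)" using B(2) h right_mult[OF v(1) hW] by simp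
      have "distinct ?ys"
        using xs(1,2) v(1) by (auto simp: distinct_map subset_iff intro!: inj_onI)
      moreover have "set ?ys \<subseteq> carrier B" using xs(2) v(1) by auto
      moreover have "x \<in> set ?ys" if "x \<in> carrier B" "?\<psi> x \<noteq> \<one>\<^bsub>A\<^esub>" for x
      proof -
        have "inv\<^bsub>B\<^esub> v \<otimes>\<^bsub>B\<^esub> x \<in> set xs" using that v(1) by (intro xs(3)) auto
        moreover have "v \<otimes>\<^bsub>B\<^esub> (inv\<^bsub>B\<^esub> v \<otimes>\<^bsub>B\<^esub> x) = x"
          using that v(1) by (simp add: cancel_left)
        ultimately show ?thesis by force
      qed
      moreover have "sum_list (map (\<lambda>x. word_length A U (?\<psi> x)) ?ys)
          = sum_list (map (\<lambda>x. word_length A U (\<phi> x)) xs)"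
        using xs(2) v(1) unfolding map_map
        by (intro arg_cong[of _ _ sum_list] map_cong) (auto simp: cancel_left)
      moreover have "tour_length V \<one>\<^bsub>B\<^esub> ?ys (v \<otimes>\<^bsub>B\<^esub> b) \<le> Suc (tour_length V \<one>\<^bsub>B\<^esub> xs b)"
      proof -
        have "tour_length V \<one>\<^bsub>B\<^esub> ?ys (v \<otimes>\<^bsub>B\<^esub> b)
            \<le> word_length B V (inv\<^bsub>B\<^esub> \<one>\<^bsub>B\<^esub> \<otimes>\<^bsub>B\<^esub> v) + tour_length V v ?ys (v \<otimes>\<^bsub>B\<^esub> b)"
          using V v b \<open>set ?ys \<subseteq> carrier B\<close> by (intro tour_length_triangle) auto
        moreover have "steps v ?ys (v \<otimes>\<^bsub>B\<^esub> b) = steps \<one>\<^bsub>B\<^esub> xs b"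
          using steps_translate[OF v(1) B.one_closed xs(2) b] v(1) by simp
        ultimately show ?thesis using v by (simp add: tour_length_def)
      qed
      ultimately show ?thesis using xs(4,5) unfolding R_def sh fst_conv snd_conv
        by (intro exI[of _ ?ys] conjI ballI impI) (simp_all only: length_map, linarith?)
    qed
  qed
  then show ?thesis using that unfolding R_def by blast
qed

end

section \<open>The subgroup\<close>

locale wreath_subgroup = wreath_product A B
  for A :: "('a, 'k) monoid_scheme" and B :: "('b, 'm) monoid_scheme" +
  fixes A' SA SA' :: "'a set" and B' SB SB' :: "'b set" and T :: "(('b \<Rightarrow> 'a) \<times> 'b) set"
  assumes A': "subgroup A' A" and B': "subgroup B' B"
    and SA: "generating_set A SA" and SB: "generating_set B SB"
    and SA': "generating_set (A\<lparr>carrier := A'\<rparr>) SA'"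
    and SB': "generating_set (B\<lparr>carrier := B'\<rparr>) SB'"
    and T: "generating_set (W\<lparr>carrier := wreath_sub A B A' B'\<rparr>) T"
begin

abbreviation H :: "(('b \<Rightarrow> 'a) \<times> 'b) set" where "H \<equiv> wreath_sub A B A' B'"

abbreviation f :: "nat \<Rightarrow> nat" where "f \<equiv> distortion A SA A' SA'"
abbreviation g :: "nat \<Rightarrow> nat" where "g \<equiv> distortion B SB B' SB'"
abbreviation \<Delta> :: "nat \<Rightarrow> nat" where "\<Delta> \<equiv> distortion W (wreath_union A B SA SB) H T"

abbreviation len_A :: "'a \<Rightarrow> nat" where "len_A \<equiv> word_length (A\<lparr>carrier := A'\<rparr>) SA'"
abbreviation len_B :: "'b \<Rightarrow> nat" where "len_B \<equiv> word_length (B\<lparr>carrier := B'\<rparr>) SB'"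
abbreviation len_H :: "('b \<Rightarrow> 'a) \<times> 'b \<Rightarrow> nat" where
  "len_H \<equiv> word_length (W\<lparr>carrier := H\<rparr>) T"

lemma generators_A: "finite SA" "SA \<subseteq> carrier A" "generate A SA = carrier A" "A' \<subseteq> generate A SA"
  using SA subgroup.subset[OF A'] by (auto simp: generating_set_def)

lemma generators_B: "finite SB" "SB \<subseteq> carrier B" "generate B SB = carrier B" "B' \<subseteq> generate B SB"
  using SB subgroup.subset[OF B'] by (auto simp: generating_set_def)

lemma generators_A': "finite SA'" "SA' \<subseteq> A'" "generate (A\<lparr>carrier := A'\<rparr>) SA' = A'"
  using SA' by (auto simp: generating_set_def)

lemma generators_B': "finite SB'" "SB' \<subseteq> B'" "generate (B\<lparr>carrier := B'\<rparr>) SB' = B'"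
  using SB' by (auto simp: generating_set_def)

lemma generators_H: "finite T" "T \<subseteq> H" "generate (W\<lparr>carrier := H\<rparr>) T = H"
  using T by (auto simp: generating_set_def)

lemma generators_W:
  "finite (wreath_union A B SA SB)" "wreath_union A B SA SB \<subseteq> carrier W"
  using generators_A generators_B by (auto simp: wreath_union_def left_closed right_closed)

lemma union_closed: "wreath_union A B A' B' \<subseteq> carrier W"
  using subgroup.subset[OF A'] subgroup.subset[OF B'] by (rule wreath_union_closed)

lemma subgroup_H: "subgroup H W"
  unfolding wreath_sub_def by (rule W.generate_is_subgroup[OF union_closed])

sublocale A': group "A\<lparr>carrier := A'\<rparr>" by (rule subgroup.subgroup_is_group[OF A' A.is_group])
sublocale B': group "B\<lparr>carrier := B'\<rparr>" by (rule subgroup.subgroup_is_group[OF B' B.is_group])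
sublocale H: group "W\<lparr>carrier := H\<rparr>"
  by (rule subgroup.subgroup_is_group[OF subgroup_H wreath_group])

lemma left_H: "a \<in> A' \<Longrightarrow> left a \<in> H"
  unfolding wreath_sub_def by (rule generate.incl) (simp add: wreath_union_def)

lemma right_H: "b \<in> B' \<Longrightarrow> right b \<in> H"
  unfolding wreath_sub_def by (rule generate.incl) (simp add: wreath_union_def)

lemma H_generated: "H \<subseteq> generate W (wreath_union A B SA SB)"
  unfolding wreath_sub_def
proof (rule W.generate_subgroup_incl)
  show "wreath_union A B A' B' \<subseteq> generate W (wreath_union A B SA SB)"
    using left_generate[OF generators_A(2)] right_generate[OF generators_B(2)]
      generators_A(4) generators_B(4) by (auto simp: wreath_union_def)
  show "subgroup (generate W (wreath_union A B SA SB)) W"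
    by (rule W.generate_is_subgroup[OF generators_W(2)])
qed

lemma H_closed: "w \<in> H \<Longrightarrow> w \<in> carrier W"
  using subgroup.subset[OF subgroup_H] by blast

text \<open>
  These conditions hold for the generators and survive products: the translate by \<open>b \<in> B'\<close> of a
  support in \<open>B'\<close> stays in \<open>B'\<close>. They allow entries to be measured in \<open>A'\<close> and steps between
  points of the support in \<open>B'\<close>.
\<close>

lemma H_entries:
  assumes "(\<phi>, b) \<in> H"
  shows "b \<in> B'" "\<And>x. x \<in> carrier B \<Longrightarrow> \<phi> x \<in> A'"
    "\<And>x. x \<in> carrier B \<Longrightarrow> \<phi> x \<noteq> \<one>\<^bsub>A\<^esub> \<Longrightarrow> x \<in> B'"
proof -
  let ?P = "\<lambda>w. snd w \<in> B' \<and> (\<forall>x\<in>carrier B. fst w x \<in> A' \<and> (fst w x \<noteq> \<one>\<^bsub>A\<^esub> \<longrightarrow> x \<in> B'))"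
  have in_B: "b \<in> B' \<Longrightarrow> b \<in> carrier B" for b using subgroup.subset[OF B'] by auto
  have left: "?P (left a)" if "a \<in> A'" for a
    using that subgroup.one_closed[OF A'] subgroup.one_closed[OF B']
    by (auto simp: wreath_left_def)
  have right: "?P (right b)" if "b \<in> B'" for b
    using that subgroup.one_closed[OF A'] by (auto simp: wreath_right_def)
  have "?P (\<phi>, b)"
    using assms unfolding wreath_sub_def
  proof induction
    case one
    then show ?case using left[OF subgroup.one_closed[OF A']] left_one by simp
  next
    case (incl h)
    then show ?case using left right unfolding wreath_union_def by blast
  next
    case (inv h)
    then consider a where "a \<in> A'" "h = left a" | b where "b \<in> B'" "h = right b"
      unfolding wreath_union_def by blast
    then show ?case
    proof cases
      case 1
      then show ?thesis
        using left[of "inv\<^bsub>A\<^esub> a"] left_inv[of a] subgroup.m_inv_closed[OF A'] subgroup.subset[OF A']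
        by (metis subsetD)
    next
      case 2
      then show ?thesis
        using right[of "inv\<^bsub>B\<^esub> b"] right_inv[of b] subgroup.m_inv_closed[OF B'] in_B by metis
    qed
  next
    case (eng h1 h2)
    obtain \<phi> b \<psi> c where e: "h1 = (\<phi>, b)" "h2 = (\<psi>, c)" by (cases h1, cases h2)
    have b: "b \<in> B'" "b \<in> carrier B" using eng(3) e in_B by auto
    have "x \<in> B'" if x: "x \<in> carrier B" and ne: "\<phi> x \<otimes>\<^bsub>A\<^esub> \<psi> (inv\<^bsub>B\<^esub> b \<otimes>\<^bsub>B\<^esub> x) \<noteq> \<one>\<^bsub>A\<^esub>" for x
    proof (cases "\<phi> x = \<one>\<^bsub>A\<^esub>")
      case True
      then have "\<psi> (inv\<^bsub>B\<^esub> b \<otimes>\<^bsub>B\<^esub> x) \<noteq> \<one>\<^bsub>A\<^esub>" using ne by auto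
      then have "inv\<^bsub>B\<^esub> b \<otimes>\<^bsub>B\<^esub> x \<in> B'" using eng(4) e b x by auto
      then have "b \<otimes>\<^bsub>B\<^esub> (inv\<^bsub>B\<^esub> b \<otimes>\<^bsub>B\<^esub> x) \<in> B'" using b subgroup.m_closed[OF B'] by blast
      then show ?thesis using b x by (simp add: cancel_left)
    next
      case False
      then show ?thesis using eng(3) e x by auto
    qed
    then show ?case using eng(3,4) b subgroup.m_closed[OF A'] subgroup.m_closed[OF B']
      unfolding e mult_wreath by auto
  qed
  then show "b \<in> B'" "\<And>x. x \<in> carrier B \<Longrightarrow> \<phi> x \<in> A'"
    "\<And>x. x \<in> carrier B \<Longrightarrow> \<phi> x \<noteq> \<one>\<^bsub>A\<^esub> \<Longrightarrow> x \<in> B'" by auto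
qed

lemma finite_H:
  assumes "finite A'" "finite B'"
  shows "finite H"
proof (rule finite_subset)
  show "H \<subseteq> (\<lambda>(\<psi>, b). (\<lambda>x\<in>carrier B. if x \<in> B' then \<psi> x else \<one>\<^bsub>A\<^esub>, b)) ` ((B' \<rightarrow>\<^sub>E A') \<times> B')"
  proof
    fix w assume w: "w \<in> H"
    obtain \<phi> b where e: "w = (\<phi>, b)" by (cases w)
    have "\<phi> \<in> extensional (carrier B)"
      using H_closed[OF w] unfolding e carrier_wreath by (auto simp: PiE_iff)
    then have "\<phi> = (\<lambda>x\<in>carrier B. if x \<in> B' then restrict \<phi> B' x else \<one>\<^bsub>A\<^esub>)"
      using H_entries[OF w[unfolded e]] by (auto simp: fun_eq_iff extensional_def)
    moreover have "restrict \<phi> B' \<in> B' \<rightarrow>\<^sub>E A'"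
      using H_entries[OF w[unfolded e]] subgroup.subset[OF B'] by auto
    ultimately show "w \<in> (\<lambda>(\<psi>, b). (\<lambda>x\<in>carrier B. if x \<in> B' then \<psi> x else \<one>\<^bsub>A\<^esub>, b)) `
        ((B' \<rightarrow>\<^sub>E A') \<times> B')"
      using H_entries(1)[OF w[unfolded e]] unfolding e
      by (intro image_eqI[of _ _ "(restrict \<phi> B', b)"]) auto
  qed
qed (use assms in \<open>simp add: finite_PiE\<close>)

section \<open>The lower bound\<close>

lemma letters_H: "T \<union> m_inv (W\<lparr>carrier := H\<rparr>) ` T \<subseteq> H"
  using H.letters_closed[of T] generators_H(2) by simp

lemma len_A_mult: "a \<in> A' \<Longrightarrow> a' \<in> A' \<Longrightarrow> len_A (a \<otimes>\<^bsub>A\<^esub> a') \<le> len_A a + len_A a'"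
  using A'.word_length_mult[of SA' a a'] generators_A' by simp

lemma len_H_mult: "v \<in> H \<Longrightarrow> w \<in> H \<Longrightarrow> len_H (v \<otimes>\<^bsub>W\<^esub> w) \<le> len_H v + len_H w"
  using H.word_length_mult[of T v w] generators_H by simp

text \<open>
  Multiplication changes an entry only by multiplying it with an entry of the other factor, so
  each letter of \<open>T\<close> lets the largest length of an entry grow by a bounded amount.
\<close>

lemma entry_le_len_H:
  obtains K where "K > 0" "\<And>\<phi> b x. (\<phi>, b) \<in> H \<Longrightarrow> x \<in> carrier B \<Longrightarrow> len_A (\<phi> x) \<le> K * len_H (\<phi>, b)"
proof -
  let ?L = "T \<union> m_inv (W\<lparr>carrier := H\<rparr>) ` T"
  have "finite ((\<lambda>x. len_A (fst t x)) ` carrier B)" if "t \<in> H" for t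
  proof (rule finite_subset)
    obtain \<phi> b where e: "t = (\<phi>, b)" by (cases t)
    show "(\<lambda>x. len_A (fst t x)) ` carrier B
        \<subseteq> insert (len_A \<one>\<^bsub>A\<^esub>) ((\<lambda>x. len_A (fst t x)) ` {x \<in> carrier B. fst t x \<noteq> \<one>\<^bsub>A\<^esub>})" by auto
    show "finite (insert (len_A \<one>\<^bsub>A\<^esub>) ((\<lambda>x. len_A (fst t x)) ` {x \<in> carrier B. fst t x \<noteq> \<one>\<^bsub>A\<^esub>}))"
      using H_closed[OF that] unfolding e carrier_wreath by simp
  qed
  then have fin: "finite (\<Union>t\<in>?L. (\<lambda>x. len_A (fst t x)) ` carrier B)"
    using generators_H(1) letters_H by (intro finite_UN_I) blast+
  define K where "K = Suc (Max (insert 0 (\<Union>t\<in>?L. (\<lambda>x. len_A (fst t x)) ` carrier B)))"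
  have K: "len_A (fst t x) \<le> K" if "t \<in> ?L" "x \<in> carrier B" for t x
    using that fin unfolding K_def by (intro le_SucI Max_ge) blast+
  have "\<forall>x\<in>carrier B. len_A (fst w x) \<le> K * len_H w" if w: "w \<in> H" for w
  proof (rule H.word_length_induct[of T w "\<lambda>w m. \<forall>x\<in>carrier B. len_A (fst w x) \<le> K * m"])
    show "T \<subseteq> carrier (W\<lparr>carrier := H\<rparr>)" "w \<in> generate (W\<lparr>carrier := H\<rparr>) T"
      using generators_H w by auto
    show "\<forall>x\<in>carrier B. len_A (fst \<one>\<^bsub>W\<lparr>carrier := H\<rparr>\<^esub> x) \<le> K * 0"
      using A'.word_length_one[of SA'] by (simp add: one_wreath)
  next
    fix s h m
    assume s: "s \<in> ?L" and h: "h \<in> carrier (W\<lparr>carrier := H\<rparr>)"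
      and IH: "\<forall>x\<in>carrier B. len_A (fst h x) \<le> K * m"
    obtain \<phi> b \<psi> c where e: "s = (\<phi>, b)" "h = (\<psi>, c)" by (cases s, cases h)
    have sH: "(\<phi>, b) \<in> H" and hH: "(\<psi>, c) \<in> H" using s h letters_H e by auto
    have "len_A (\<phi> x \<otimes>\<^bsub>A\<^esub> \<psi> (inv\<^bsub>B\<^esub> b \<otimes>\<^bsub>B\<^esub> x)) \<le> K + K * m" if x: "x \<in> carrier B" for x
    proof -
      have y: "inv\<^bsub>B\<^esub> b \<otimes>\<^bsub>B\<^esub> x \<in> carrier B"
        using x H_entries(1)[OF sH] subgroup.subset[OF B'] by auto
      show ?thesis
        using len_A_mult[OF H_entries(2)[OF sH x] H_entries(2)[OF hH y]] K[OF s x] IH y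
        unfolding e by fastforce
    qed
    then show "\<forall>x\<in>carrier B. len_A (fst (s \<otimes>\<^bsub>W\<lparr>carrier := H\<rparr>\<^esub> h) x) \<le> K * Suc m"
      unfolding e by (simp add: mult_wreath)
  qed
  then show ?thesis using that[of K] K_def by fastforce
qed

lemma snd_hom: "snd \<in> hom (W\<lparr>carrier := H\<rparr>) (B\<lparr>carrier := B'\<rparr>)"
  by (rule homI) (auto simp: mult_wreath H_entries(1))

lemma snd_closed: "w \<in> H \<Longrightarrow> snd w \<in> B'"
  using H_entries(1)[of "fst w" "snd w"] by simp

lemma left_length_le:
  assumes "a \<in> carrier A"
  shows "word_length W (wreath_union A B SA SB) (left a) \<le> word_length A SA a"
proof -
  have "word_length W (wreath_union A B SA SB) (left s) \<le> 1" if "s \<in> SA \<union> m_inv A ` SA" for s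
  proof (rule W.word_length_letter[OF generators_W(2)])
    show "left s \<in> wreath_union A B SA SB \<union> m_inv W ` wreath_union A B SA SB"
      using that by (simp only: wreath_union_letters[OF generators_A(2) generators_B(2)])
        (simp add: wreath_union_def)
  qed
  then have "word_length W (wreath_union A B SA SB) (left a) \<le> 1 * word_length A SA a"
    using generators_A(3) left_generate[OF generators_A(2)] assms
    by (intro hom_length_le[OF A.is_group wreath_group left_hom generators_A(2,3) generators_W(2)])
      auto
  then show ?thesis by simp
qed

lemma right_length_le:
  assumes "b \<in> carrier B"
  shows "word_length W (wreath_union A B SA SB) (right b) \<le> word_length B SB b"
proof -
  have "word_length W (wreath_union A B SA SB) (right s) \<le> 1" if "s \<in> SB \<union> m_inv B ` SB" for s
  proof (rule W.word_length_letter[OF generators_W(2)])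
    show "right s \<in> wreath_union A B SA SB \<union> m_inv W ` wreath_union A B SA SB"
      using that by (simp only: wreath_union_letters[OF generators_A(2) generators_B(2)])
        (simp add: wreath_union_def)
  qed
  then have "word_length W (wreath_union A B SA SB) (right b) \<le> 1 * word_length B SB b"
    using generators_B(3) right_generate[OF generators_B(2)] assms
    by (intro hom_length_le[OF B.is_group wreath_group right_hom generators_B(2,3) generators_W(2)])
      auto
  then show ?thesis by simp
qed

lemma f_preceq: "f \<preceq> \<Delta>"
proof -
  obtain K where K: "\<And>\<phi> b x. (\<phi>, b) \<in> H \<Longrightarrow> x \<in> carrier B \<Longrightarrow> len_A (\<phi> x) \<le> K * len_H (\<phi>, b)"
    by (rule entry_le_len_H) blast
  show ?thesis
  proof (rule preceqI)
    fix n
    obtain a where a: "a \<in> A'" "word_length A SA a \<le> n" "len_A a = f n"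
      using A.distortion_attained[OF generators_A(1,2,4) subgroup.one_closed[OF A']] by metis
    have "len_A (fst (left a) \<one>\<^bsub>B\<^esub>) \<le> K * len_H (left a)"
      using K[of "fst (left a)" "snd (left a)" "\<one>\<^bsub>B\<^esub>"] left_H[OF a(1)] by simp
    then have "f n \<le> K * len_H (left a)" using a(3) by (simp add: wreath_left_def)
    also have "len_H (left a) \<le> \<Delta> n"
      using left_length_le[of a] a(1,2) subgroup.subset[OF A']
      by (intro W.word_length_le_distortion[OF generators_W H_generated left_H[OF a(1)]]) fastforce
    finally show "f n \<le> K * \<Delta> n + 0" by simp
  qed
qed

lemma g_preceq: "g \<preceq> \<Delta>"
proof -
  have "\<exists>K>0. \<forall>w\<in>H. len_B (snd w) \<le> K * len_H w"
    using hom_lipschitz[OF H.is_group B'.is_group snd_hom, of T SB'] generators_H generators_B'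
      snd_closed by (simp add: image_subset_iff)
  then obtain K where K: "\<And>w. w \<in> H \<Longrightarrow> len_B (snd w) \<le> K * len_H w" by blast
  show ?thesis
  proof (rule preceqI)
    fix n
    obtain b where b: "b \<in> B'" "word_length B SB b \<le> n" "len_B b = g n"
      using B.distortion_attained[OF generators_B(1,2,4) subgroup.one_closed[OF B']] by metis
    have "g n \<le> K * len_H (right b)"
      using K[OF right_H[OF b(1)]] b(3) by (simp add: wreath_right_def)
    also have "len_H (right b) \<le> \<Delta> n"
      using right_length_le[of b] b(1,2) subgroup.subset[OF B']
      by (intro W.word_length_le_distortion[OF generators_W H_generated right_H[OF b(1)]]) fastforce
    finally show "g n \<le> K * \<Delta> n + 0" by simp
  qed
qed

section \<open>The upper bound\<close>

lemma left_hom_H: "left \<in> hom (A\<lparr>carrier := A'\<rparr>) (W\<lparr>carrier := H\<rparr>)"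
  using hom_mult[OF left_hom] subgroup.subset[OF A'] left_H by (intro homI) auto

lemma right_hom_H: "right \<in> hom (B\<lparr>carrier := B'\<rparr>) (W\<lparr>carrier := H\<rparr>)"
  using hom_mult[OF right_hom] subgroup.subset[OF B'] right_H by (intro homI) auto

text \<open>
  Conjugating an element of \<open>A\<close> at index \<open>1\<close> by \<open>x\<close> changes the entry at \<open>x\<close> instead.
\<close>

lemma mult_site:
  assumes "x \<in> carrier B" "a \<in> carrier A" "(\<phi>, b) \<in> carrier W"
  shows "right x \<otimes>\<^bsub>W\<^esub> (left a \<otimes>\<^bsub>W\<^esub> (right (inv\<^bsub>B\<^esub> x) \<otimes>\<^bsub>W\<^esub> (\<phi>, b))) = (\<phi>(x := a \<otimes>\<^bsub>A\<^esub> \<phi> x), b)"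
proof -
  let ?\<psi> = "\<lambda>y\<in>carrier B. \<phi> (x \<otimes>\<^bsub>B\<^esub> y)"
  let ?\<xi> = "?\<psi>(\<one>\<^bsub>B\<^esub> := a \<otimes>\<^bsub>A\<^esub> \<phi> x)"
  have b: "b \<in> carrier B" and ext: "\<phi> \<in> extensional (carrier B)"
    using assms(3) unfolding carrier_wreath by (auto simp: PiE_iff)
  have 1: "right (inv\<^bsub>B\<^esub> x) \<otimes>\<^bsub>W\<^esub> (\<phi>, b) = (?\<psi>, inv\<^bsub>B\<^esub> x \<otimes>\<^bsub>B\<^esub> b)"
    using assms(1) by (simp add: right_mult[OF _ assms(3)])
  then have c1: "(?\<psi>, inv\<^bsub>B\<^esub> x \<otimes>\<^bsub>B\<^esub> b) \<in> carrier W"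
    using W.m_closed[OF right_closed assms(3), of "inv\<^bsub>B\<^esub> x"] assms(1) by simp
  have 2: "left a \<otimes>\<^bsub>W\<^esub> (?\<psi>, inv\<^bsub>B\<^esub> x \<otimes>\<^bsub>B\<^esub> b) = (?\<xi>, inv\<^bsub>B\<^esub> x \<otimes>\<^bsub>B\<^esub> b)"
    using left_mult[OF assms(2) c1] assms(1) by simp
  then have c2: "(?\<xi>, inv\<^bsub>B\<^esub> x \<otimes>\<^bsub>B\<^esub> b) \<in> carrier W"
    using W.m_closed[OF left_closed[OF assms(2)] c1] by simp
  have "inv\<^bsub>B\<^esub> x \<otimes>\<^bsub>B\<^esub> y = \<one>\<^bsub>B\<^esub> \<longleftrightarrow> y = x" if "y \<in> carrier B" for y
    using assms(1) that cancel_left(2)[of x y] by auto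
  then have "(\<lambda>y\<in>carrier B. ?\<xi> (inv\<^bsub>B\<^esub> x \<otimes>\<^bsub>B\<^esub> y)) = \<phi>(x := a \<otimes>\<^bsub>A\<^esub> \<phi> x)"
    using assms(1) ext by (auto simp: fun_eq_iff cancel_left extensional_def)
  then show ?thesis
    unfolding 1 2 right_mult[OF assms(1) c2] using assms(1) b by (simp add: cancel_left)
qed

text \<open>
  An element is assembled by touring its support inside \<open>B'\<close>: go from \<open>c\<close> to the next site,
  create the entry there, continue, and finish at \<open>b\<close>. The tour may start at an arbitrary
  \<open>c\<close> so that the rest of a tour is again of the same form.
\<close>

lemma len_H_le_tour:
  assumes left: "\<And>a. a \<in> A' \<Longrightarrow> len_H (left a) \<le> K * len_A a"
    and right: "\<And>b. b \<in> B' \<Longrightarrow> len_H (right b) \<le> K * len_B b"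
    and "(\<phi>, b) \<in> H" "c \<in> B'" "distinct xs" "set xs \<subseteq> B'"
    and "\<And>x. x \<in> carrier B \<Longrightarrow> \<phi> x \<noteq> \<one>\<^bsub>A\<^esub> \<Longrightarrow> x \<in> set xs"
  shows "len_H (right (inv\<^bsub>B\<^esub> c) \<otimes>\<^bsub>W\<^esub> (\<phi>, b))
    \<le> K * (sum_list (map (\<lambda>x. len_A (\<phi> x)) xs) + sum_list (map len_B (steps c xs b)))"
  using assms(3-)
proof (induction xs arbitrary: c \<phi>)
  case Nil
  have c: "c \<in> carrier B" "inv\<^bsub>B\<^esub> c \<in> B'" and b: "b \<in> B'" "b \<in> carrier B"
    using Nil subgroup.subset[OF B'] subgroup.m_inv_closed[OF B'] H_entries(1) by blast+
  have "\<phi> \<in> extensional (carrier B)"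
    using H_closed[OF Nil(1)] unfolding carrier_wreath by (auto simp: PiE_iff)
  then have "\<phi> = (\<lambda>x\<in>carrier B. \<one>\<^bsub>A\<^esub>)"
    using Nil(5) by (auto simp: fun_eq_iff extensional_def)
  then have "right (inv\<^bsub>B\<^esub> c) \<otimes>\<^bsub>W\<^esub> (\<phi>, b) = right (inv\<^bsub>B\<^esub> c \<otimes>\<^bsub>B\<^esub> b)"
    using hom_mult[OF right_hom, of "inv\<^bsub>B\<^esub> c" b] b c by (simp add: wreath_right_def)
  then show ?case using right[OF subgroup.m_closed[OF B' c(2) b(1)]] by simp
next
  case (Cons x xs)
  have mem: "c \<in> carrier B" "inv\<^bsub>B\<^esub> c \<in> B'" "x \<in> B'" "x \<in> carrier B" "inv\<^bsub>B\<^esub> x \<in> B'"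
    using Cons.prems subgroup.subset[OF B'] subgroup.m_inv_closed[OF B'] by auto
  have a: "\<phi> x \<in> A'" "\<phi> x \<in> carrier A" "inv\<^bsub>A\<^esub> \<phi> x \<in> A'"
    using H_entries(2)[OF Cons.prems(1) mem(4)] subgroup.subset[OF A']
      subgroup.m_inv_closed[OF A'] by auto
  let ?\<psi> = "\<phi>(x := \<one>\<^bsub>A\<^esub>)"
  note mult_H = subgroup.m_closed[OF subgroup_H]
  have "right x \<otimes>\<^bsub>W\<^esub> (left (inv\<^bsub>A\<^esub> \<phi> x) \<otimes>\<^bsub>W\<^esub> (right (inv\<^bsub>B\<^esub> x) \<otimes>\<^bsub>W\<^esub> (\<phi>, b))) \<in> H"
    using mem a Cons.prems(1) by (intro mult_H left_H right_H)
  then have \<psi>: "(?\<psi>, b) \<in> H"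
    using mult_site[OF mem(4) A.inv_closed[OF a(2)] H_closed[OF Cons.prems(1)]] a(2) by simp
  define r where "r = right (inv\<^bsub>B\<^esub> x) \<otimes>\<^bsub>W\<^esub> (?\<psi>, b)"
  have r: "r \<in> H" unfolding r_def using mem \<psi> by (intro mult_H right_H)
  have "right x \<otimes>\<^bsub>W\<^esub> (left (\<phi> x) \<otimes>\<^bsub>W\<^esub> r) = (\<phi>, b)"
    using mult_site[OF mem(4) a(2) H_closed[OF \<psi>]] a(2) unfolding r_def by simp
  then have "right (inv\<^bsub>B\<^esub> c) \<otimes>\<^bsub>W\<^esub> (\<phi>, b)
      = right (inv\<^bsub>B\<^esub> c) \<otimes>\<^bsub>W\<^esub> (right x \<otimes>\<^bsub>W\<^esub> (left (\<phi> x) \<otimes>\<^bsub>W\<^esub> r))" by simp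
  also have "\<dots> = right (inv\<^bsub>B\<^esub> c \<otimes>\<^bsub>B\<^esub> x) \<otimes>\<^bsub>W\<^esub> (left (\<phi> x) \<otimes>\<^bsub>W\<^esub> r)"
    using mem a H_closed[OF r] by (simp add: hom_mult[OF right_hom] W.m_assoc left_closed right_closed)
  finally have "len_H (right (inv\<^bsub>B\<^esub> c) \<otimes>\<^bsub>W\<^esub> (\<phi>, b))
      = len_H (right (inv\<^bsub>B\<^esub> c \<otimes>\<^bsub>B\<^esub> x) \<otimes>\<^bsub>W\<^esub> (left (\<phi> x) \<otimes>\<^bsub>W\<^esub> r))" by simp
  also have "\<dots> \<le> len_H (right (inv\<^bsub>B\<^esub> c \<otimes>\<^bsub>B\<^esub> x)) + len_H (left (\<phi> x) \<otimes>\<^bsub>W\<^esub> r)"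
    using mem a r by (intro len_H_mult mult_H left_H right_H subgroup.m_closed[OF B'])
  also have "len_H (left (\<phi> x) \<otimes>\<^bsub>W\<^esub> r) \<le> len_H (left (\<phi> x)) + len_H r"
    using a r by (intro len_H_mult left_H)
  also have "len_H (right (inv\<^bsub>B\<^esub> c \<otimes>\<^bsub>B\<^esub> x)) \<le> K * len_B (inv\<^bsub>B\<^esub> c \<otimes>\<^bsub>B\<^esub> x)"
    using mem by (intro right subgroup.m_closed[OF B'])
  also have "len_H (left (\<phi> x)) \<le> K * len_A (\<phi> x)" using a by (intro left)
  also have "len_H r
      \<le> K * (sum_list (map (\<lambda>y. len_A (?\<psi> y)) xs) + sum_list (map len_B (steps x xs b)))"
    unfolding r_def
  proof (rule Cons.IH[OF \<psi> mem(3)])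
    show "distinct xs" "set xs \<subseteq> B'" using Cons.prems(3,4) by auto
    show "y \<in> set xs" if "y \<in> carrier B" "?\<psi> y \<noteq> \<one>\<^bsub>A\<^esub>" for y
      using Cons.prems(5)[of y] that by (auto split: if_splits)
  qed
  also have "map (\<lambda>y. len_A (?\<psi> y)) xs = map (\<lambda>y. len_A (\<phi> y)) xs"
    using Cons.prems(3) by (intro map_cong) auto
  finally show ?case by (simp add: algebra_simps)
qed

text \<open>
  The tour of \<^term>\<open>w\<close> found in \<open>A \<wr> B\<close> is repeated inside \<open>A' \<wr> B'\<close>; the list \<open>ns\<close>
  collects the lengths of the entries in \<open>A\<close> and \<open>ms\<close> those of the steps in \<open>B\<close>.
\<close>

lemma len_H_le_entries_steps:
  obtains K where "\<And>w n. w \<in> H \<Longrightarrow> word_length W (wreath_union A B SA SB) w \<le> n \<Longrightarrow>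
    \<exists>ns ms. sum_list ns \<le> n \<and> length ns \<le> n + 1 \<and> sum_list ms \<le> n \<and> length ms \<le> n + 1 \<and>
      len_H w \<le> K * (sum_list (map f ns) + sum_list (map g ms))"
proof -
  have "\<exists>K>0. \<forall>a\<in>A'. len_H (left a) \<le> K * len_A a"
    using hom_lipschitz[OF A'.is_group H.is_group left_hom_H, of SA' T]
      generators_H generators_A' left_H by (simp add: image_subset_iff)
  then obtain K1 where K1: "\<And>a. a \<in> A' \<Longrightarrow> len_H (left a) \<le> K1 * len_A a" by blast
  have "\<exists>K>0. \<forall>b\<in>B'. len_H (right b) \<le> K * len_B b"
    using hom_lipschitz[OF B'.is_group H.is_group right_hom_H, of SB' T]
      generators_H generators_B' right_H by (simp add: image_subset_iff)
  then obtain K2 where K2: "\<And>b. b \<in> B' \<Longrightarrow> len_H (right b) \<le> K2 * len_B b" by blast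
  define K where "K = K1 + K2"
  have left: "len_H (left a) \<le> K * len_A a" if "a \<in> A'" for a
    using K1[OF that] unfolding K_def by (simp add: add_mult_distrib)
  have right: "len_H (right b) \<le> K * len_B b" if "b \<in> B'" for b
    using K2[OF that] unfolding K_def by (simp add: add_mult_distrib)
  have "\<exists>ns ms. sum_list ns \<le> n \<and> length ns \<le> n + 1 \<and> sum_list ms \<le> n \<and> length ms \<le> n + 1 \<and>
      len_H w \<le> K * (sum_list (map f ns) + sum_list (map g ms))"
    if w: "w \<in> H" and n: "word_length W (wreath_union A B SA SB) w \<le> n" for w n
  proof -
    obtain \<phi> b where e: "w = (\<phi>, b)" by (cases w)
    note ent = H_entries[OF w[unfolded e]]
    have b: "b \<in> carrier B" using ent(1) subgroup.subset[OF B'] by auto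
    obtain xs where xs: "distinct xs" "set xs \<subseteq> carrier B"
      "\<And>x. x \<in> carrier B \<Longrightarrow> fst w x \<noteq> \<one>\<^bsub>A\<^esub> \<Longrightarrow> x \<in> set xs"
      "length xs \<le> word_length W (wreath_union A B SA SB) w"
      "sum_list (map (\<lambda>x. word_length A SA (fst w x)) xs) + tour_length SB \<one>\<^bsub>B\<^esub> xs (snd w)
        \<le> word_length W (wreath_union A B SA SB) w"
      using support_tour[OF generators_A(2,3) generators_B(2,3)] H_generated w by blast
    \<comment> \<open>The tour may visit sites outside \<open>B'\<close>, at which a changed entry was restored later.
      Omitting the sites with trivial entry leaves points of \<open>B'\<close> and shortens the tour.\<close>
    let ?ys = "filter (\<lambda>x. \<phi> x \<noteq> \<one>\<^bsub>A\<^esub>) xs"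
    let ?ns = "map (\<lambda>x. word_length A SA (\<phi> x)) ?ys"
    let ?ms = "map (word_length B SB) (steps \<one>\<^bsub>B\<^esub> ?ys b)"
    have ys: "set ?ys \<subseteq> B'" using ent(3) xs(2) by auto
    have st: "set (steps \<one>\<^bsub>B\<^esub> ?ys b) \<subseteq> B'"
      using steps_closed[OF B' subgroup.one_closed[OF B'] ys ent(1)] .
    have "sum_list ?ns \<le> sum_list (map (\<lambda>x. word_length A SA (\<phi> x)) xs)"
      by (rule sum_list_filter_le_nat)
    moreover have "sum_list ?ms \<le> tour_length SB \<one>\<^bsub>B\<^esub> xs b"
      using tour_length_filter[OF generators_B(2,3) B.one_closed xs(2) b] by (simp add: tour_length_def)
    ultimately have sums: "sum_list ?ns \<le> n" "sum_list ?ms \<le> n"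
      using xs(5) n unfolding e by simp_all
    have lens: "length ?ns \<le> n + 1" "length ?ms \<le> n + 1"
      using order_trans[OF length_filter_le[of "\<lambda>x. \<phi> x \<noteq> \<one>\<^bsub>A\<^esub>" xs] order_trans[OF xs(4) n]]
      by simp_all
    have "right (inv\<^bsub>B\<^esub> \<one>\<^bsub>B\<^esub>) \<otimes>\<^bsub>W\<^esub> (\<phi>, b) = w"
      using H_closed[OF w] unfolding e by (simp add: right_one)
    then have "len_H w
        \<le> K * (sum_list (map (\<lambda>x. len_A (\<phi> x)) ?ys) + sum_list (map len_B (steps \<one>\<^bsub>B\<^esub> ?ys b)))"
      using len_H_le_tour[OF left right w[unfolded e] subgroup.one_closed[OF B'] _ ys] xs(1,3)
      unfolding e by simp
    also have "sum_list (map (\<lambda>x. len_A (\<phi> x)) ?ys) \<le> sum_list (map f ?ns)"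
      using ent(2) xs(2) unfolding map_map
      by (intro sum_list_mono) (auto intro!: A.word_length_le_distortion[OF generators_A(1,2,4)])
    also have "sum_list (map len_B (steps \<one>\<^bsub>B\<^esub> ?ys b)) \<le> sum_list (map g ?ms)"
      using st unfolding map_map
      by (intro sum_list_mono) (auto intro!: B.word_length_le_distortion[OF generators_B(1,2,4)])
    finally show ?thesis using sums lens by (intro exI[of _ ?ns] exI[of _ ?ms]) simp
  qed
  then show ?thesis by (rule that)
qed

text \<open>
  If \<open>A'\<close> or \<open>B'\<close> is infinite, its distortion grows at least linearly and absorbs the linear
  error terms of \<^const>\<open>sum_bound\<close>; otherwise \<open>A' \<wr> B'\<close> is finite.
\<close>

lemma distortion_preceq:
  assumes "sum_bound f p" "sum_bound g q" "f \<preceq> p" "g \<preceq> q"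
  shows "\<Delta> \<preceq> (\<lambda>n. max (p n) (q n))"
proof (cases "finite A' \<and> finite B'")
  case True
  then have fin: "finite H" by (simp add: finite_H)
  show ?thesis
  proof (rule preceqI)
    fix n
    obtain h where "h \<in> H" "len_H h = \<Delta> n"
      using W.distortion_attained[OF generators_W H_generated subgroup.one_closed[OF subgroup_H]]
      by metis
    then have "\<Delta> n \<in> len_H ` H" by (metis imageI)
    then have "\<Delta> n \<le> Max (len_H ` H)" using fin by simp
    then show "\<Delta> n \<le> 0 * max (p n) (q n) + Max (len_H ` H)" by simp
  qed
next
  case False
  let ?m = "\<lambda>n. max (p n) (q n)"
  have "p \<preceq> ?m" "q \<preceq> ?m" by (rule preceqI[of _ 1 _ 0]; simp)+
  then have "(\<lambda>n. n) \<preceq> ?m"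
    using A.identity_preceq_distortion[OF generators_A(1,2,4) A' SA']
      B.identity_preceq_distortion[OF generators_B(1,2,4) B' SB'] False assms(3,4)
      preceq_trans by metis
  then obtain C0 D0 :: real where 0: "C0 > 0" "D0 \<ge> 0" "\<And>n. real n \<le> C0 * real (?m n) + D0"
    by (rule preceqE) blast
  obtain C1 D1 :: real where 1: "C1 \<ge> 0" "D1 \<ge> 0"
    "\<And>ns n. sum_list ns \<le> n \<Longrightarrow> length ns \<le> n + 1 \<Longrightarrow>
      real (sum_list (map f ns)) \<le> C1 * real (p n) + D1 * (real n + 1)"
    using assms(1) unfolding sum_bound_def by blast
  obtain C2 D2 :: real where 2: "C2 \<ge> 0" "D2 \<ge> 0"
    "\<And>ns n. sum_list ns \<le> n \<Longrightarrow> length ns \<le> n + 1 \<Longrightarrow>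
      real (sum_list (map g ns)) \<le> C2 * real (q n) + D2 * (real n + 1)"
    using assms(2) unfolding sum_bound_def by blast
  obtain K where K: "\<And>w n. w \<in> H \<Longrightarrow> word_length W (wreath_union A B SA SB) w \<le> n \<Longrightarrow>
    \<exists>ns ms. sum_list ns \<le> n \<and> length ns \<le> n + 1 \<and> sum_list ms \<le> n \<and> length ms \<le> n + 1 \<and>
      len_H w \<le> K * (sum_list (map f ns) + sum_list (map g ms))"
    by (rule len_H_le_entries_steps) blast
  define E where "E = C1 + C2 + (D1 + D2) * C0"
  define F where "F = (D1 + D2) * (D0 + 1)"
  have EF: "E \<ge> 0" "F \<ge> 0" using 0 1 2 by (simp_all add: E_def F_def)
  have "real (\<Delta> n) \<le> (real K * E + 1) * real (?m n) + real K * F" for n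
  proof -
    obtain h where h: "h \<in> H" "word_length W (wreath_union A B SA SB) h \<le> n" "len_H h = \<Delta> n"
      using W.distortion_attained[OF generators_W H_generated subgroup.one_closed[OF subgroup_H]]
      by metis
    then obtain ns ms where nm: "sum_list ns \<le> n" "length ns \<le> n + 1" "sum_list ms \<le> n"
      "length ms \<le> n + 1" "\<Delta> n \<le> K * (sum_list (map f ns) + sum_list (map g ms))"
      using K[OF h(1,2)] by auto
    have "C1 * real (p n) \<le> C1 * real (?m n)" "C2 * real (q n) \<le> C2 * real (?m n)"
      using 1(1) 2(1) by (simp_all add: mult_left_mono)
    moreover have "(D1 + D2) * (real n + 1) \<le> (D1 + D2) * (C0 * real (?m n) + D0 + 1)"
      using 0(3)[of n] 1(2) 2(2) by (intro mult_left_mono) auto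
    ultimately have "real (sum_list (map f ns)) + real (sum_list (map g ms)) \<le> E * real (?m n) + F"
      using 1(3)[OF nm(1,2)] 2(3)[OF nm(3,4)] unfolding E_def F_def
      by (simp only: distrib_left distrib_right mult.assoc mult_1_right)
    then have "real K * (real (sum_list (map f ns)) + real (sum_list (map g ms)))
        \<le> real K * (E * real (?m n) + F)" by (intro mult_left_mono) auto
    moreover have "real (\<Delta> n) \<le> real K * (real (sum_list (map f ns)) + real (sum_list (map g ms)))"
      using nm(5) by (metis of_nat_add of_nat_le_iff of_nat_mult)
    moreover have "real K * (E * real (?m n) + F) = real K * E * real (?m n) + real K * F"
      by (simp add: distrib_left mult.assoc)
    moreover have "(real K * E + 1) * real (?m n) = real K * E * real (?m n) + real (?m n)"
      by (simp add: distrib_right)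
    ultimately show ?thesis by linarith
  qed
  then show ?thesis unfolding preceq_def using EF
    by (intro exI[of _ "real K * E + 1"] exI[of _ "real K * F"] conjI allI add_nonneg_pos) simp_all
qed

lemma mono_f: "mono f"
  by (rule A.distortion_mono[OF generators_A(1,2,4) subgroup.one_closed[OF A']])

lemma mono_g: "mono g"
  by (rule B.distortion_mono[OF generators_B(1,2,4) subgroup.one_closed[OF B']])

end

theorem theorem3p5:
  fixes A :: "('a, 'k) monoid_scheme" and B :: "('b, 'm) monoid_scheme"
    and A' SA SA' :: "'a set" and B' SB SB' :: "'b set"
    and T :: "(('b \<Rightarrow> 'a) \<times> 'b) set"
    and f g \<Delta> :: "nat \<Rightarrow> nat"
  assumes "group A" and "group B"
    and "subgroup A' A" and "subgroup B' B"
    and "generating_set A SA" and "generating_set B SB"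
    and "generating_set (A\<lparr>carrier := A'\<rparr>) SA'" and "generating_set (B\<lparr>carrier := B'\<rparr>) SB'"
    and "generating_set ((wreath A B)\<lparr>carrier := wreath_sub A B A' B'\<rparr>) T"
    and "f = distortion A SA A' SA'" and "g = distortion B SB B' SB'"
    and "\<Delta> = distortion (wreath A B) (wreath_union A B SA SB) (wreath_sub A B A' B') T"
  shows "(\<lambda>n. f n + g n) \<preceq> \<Delta> \<and>
    (\<lambda>n. f n + g n) \<asymp> (\<lambda>n. max (f n) (g n)) \<and>
    (equiv_superadditive f \<and> equiv_superadditive g \<longrightarrow>
      \<Delta> \<preceq> (\<lambda>n. max (f n) (g n))) \<and>
    (equiv_superadditive f \<and> \<not> equiv_superadditive g \<longrightarrow>
      \<Delta> \<preceq> (\<lambda>n. max (f n) (n * g n))) \<and>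
    (\<not> equiv_superadditive f \<and> equiv_superadditive g \<longrightarrow>
      \<Delta> \<preceq> (\<lambda>n. max (n * f n) (g n))) \<and>
    (\<not> equiv_superadditive f \<and> \<not> equiv_superadditive g \<longrightarrow>
      \<Delta> \<preceq> (\<lambda>n. max (n * f n) (n * g n)))"
proof -
  interpret A: group A by fact
  interpret B: group B by fact
  interpret wreath_product A B by unfold_locales
  interpret S: wreath_subgroup A B A' SA SA' B' SB SB' T
    by (intro wreath_subgroup.intro wreath_subgroup_axioms.intro wreath_product_axioms assms)
  have eqs: "f = S.f" "g = S.g" "\<Delta> = S.\<Delta>" using assms by simp_all
  have super_f: "equiv_superadditive f \<Longrightarrow> sum_bound f f" by (rule equiv_superadditive_sum_bound)
  have super_g: "equiv_superadditive g \<Longrightarrow> sum_bound g g" by (rule equiv_superadditive_sum_bound)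
  have bound_f: "sum_bound f (\<lambda>n. n * f n)" unfolding eqs by (rule mono_sum_bound[OF S.mono_f])
  have bound_g: "sum_bound g (\<lambda>n. n * g n)" unfolding eqs by (rule mono_sum_bound[OF S.mono_g])
  have upper: "\<Delta> \<preceq> (\<lambda>n. max (p n) (q n))"
    if "sum_bound f p" "sum_bound g q" "f \<preceq> p" "g \<preceq> q" for p q
    using S.distortion_preceq that unfolding eqs by blast
  have "(\<lambda>n. f n + g n) \<preceq> \<Delta>"
    unfolding eqs by (rule preceq_add[OF S.f_preceq S.g_preceq])
  moreover have "(\<lambda>n. f n + g n) \<preceq> (\<lambda>n. max (f n) (g n))"
    by (rule preceqI[of _ 2 _ 0]) simp
  moreover have "(\<lambda>n. max (f n) (g n)) \<preceq> (\<lambda>n. f n + g n)"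
    by (rule preceqI[of _ 1 _ 0]) simp
  ultimately show ?thesis
    unfolding equivalent_def
    using upper[OF super_f super_g preceq_refl preceq_refl]
      upper[OF super_f bound_g preceq_refl preceq_times_argument]
      upper[OF bound_f super_g preceq_times_argument preceq_refl]
      upper[OF bound_f bound_g preceq_times_argument preceq_times_argument]
    by blast
qed

end
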